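(* For all positive integers $n,d$ we have $f(n,d)\leq \frac{n}{2}+d-1$. Equivalently, every graph $G$ on $n$ vertices with minimum degree $\delta(G)\geq \frac{n}{2}+d-1$ is $d$-rigid.
   Context: All graphs are finite and simple. A $d$-dimensional framework $(G,p)$ is a graph $G=(V,E)$ with a map $p:V\to\mathbb{R}^d$; it is rigid if every continuous motion of the vertices starting at $p$ that keeps all edge lengths $\|p(u)-p(v)\|$, $uv\in E$, constant also keeps all pairwise distances between vertices constant. It is generic if the coordinates of $p$ are algebraically independent over $\mathbb{Q}$. A graph $G$ is $d$-rigid (rigid in $\mathbb{R}^d$) if some (equivalently every) generic $d$-dimensional framework $(G,p)$ is rigid. $\delta(G)$ denotes the minimum degree. For $n,d\in\mathbb{N}$, $f(n,d)$ is the smallest integer such that every $n$-vertex graph $G$ with $\delta(G)\geq f(n,d)$ is $d$-rigid. *)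

theory Defs
  imports "HOL-Analysis.Analysis"
begin

definition simple_graph :: "'a set \<Rightarrow> ('a \<Rightarrow> 'a \<Rightarrow> bool) \<Rightarrow> bool" where
  "simple_graph V E \<longleftrightarrow> finite V \<and>
     (\<forall>u v. E u v \<longrightarrow> u \<in> V \<and> v \<in> V \<and> u \<noteq> v \<and> E v u)"

definition degree :: "'a set \<Rightarrow> ('a \<Rightarrow> 'a \<Rightarrow> bool) \<Rightarrow> 'a \<Rightarrow> nat" where
  "degree V E v = card {u \<in> V. E v u}"

definition min_degree :: "'a set \<Rightarrow> ('a \<Rightarrow> 'a \<Rightarrow> bool) \<Rightarrow> nat" where
  "min_degree V E = Min (degree V E ` V)"

text \<open>A family of reals indexed by I is algebraically independent over the
  rationals: the family is injective on I and no nonzero polynomial with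
  rational coefficients (in finitely many of the variables) vanishes on it.
  A polynomial is given by a finite set M of exponent vectors supported in a
  finite set S of indices, with rational coefficients a.\<close>
definition alg_indep_Q :: "'i set \<Rightarrow> ('i \<Rightarrow> real) \<Rightarrow> bool" where
  "alg_indep_Q I c \<longleftrightarrow> inj_on c I \<and>
     (\<forall>S M (a :: ('i \<Rightarrow> nat) \<Rightarrow> rat).
        finite S \<and> S \<subseteq> I \<and> finite M \<and> (\<forall>m\<in>M. \<forall>i. i \<notin> S \<longrightarrow> m i = 0) \<and>
        (\<Sum>m\<in>M. of_rat (a m) * (\<Prod>i\<in>S. c i ^ m i)) = 0
        \<longrightarrow> (\<forall>m\<in>M. a m = 0))"

definition generic_framework :: "'a set \<Rightarrow> ('a \<Rightarrow> real ^ 'd) \<Rightarrow> bool" where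
  "generic_framework V p \<longleftrightarrow> alg_indep_Q (V \<times> UNIV) (\<lambda>(v, k). p v $ k)"

definition rigid_framework ::
  "'a set \<Rightarrow> ('a \<Rightarrow> 'a \<Rightarrow> bool) \<Rightarrow> ('a \<Rightarrow> real ^ 'd) \<Rightarrow> bool" where
  "rigid_framework V E p \<longleftrightarrow>
     (\<forall>x :: real \<Rightarrow> 'a \<Rightarrow> real ^ 'd.
        (\<forall>v\<in>V. continuous_on {0..1} (\<lambda>t. x t v)) \<and>
        (\<forall>v\<in>V. x 0 v = p v) \<and>
        (\<forall>t\<in>{0..1}. \<forall>u\<in>V. \<forall>v\<in>V. E u v \<longrightarrow> dist (x t u) (x t v) = dist (p u) (p v))
        \<longrightarrow> (\<forall>t\<in>{0..1}. \<forall>u\<in>V. \<forall>v\<in>V. dist (x t u) (x t v) = dist (p u) (p v)))"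

definition graph_rigid :: "'a set \<Rightarrow> ('a \<Rightarrow> 'a \<Rightarrow> bool) \<Rightarrow> ('d::finite) itself \<Rightarrow> bool" where
  "graph_rigid V E (_ :: 'd itself) \<longleftrightarrow>
     (\<forall>p :: 'a \<Rightarrow> real ^ 'd. generic_framework V p \<longrightarrow> rigid_framework V E p)"

end

theory Submission
  imports Defs
begin

text \<open>
  Let \<open>n = |V|\<close>, let \<open>k\<close> bound the degrees of the complement graph, so that \<open>n \<ge> 2d + 2k\<close>, and
  let \<open>\<mu>\<close> be an infinitesimal motion of \<open>(G, p)\<close>. The symmetric matrix
  \<open>D\<^sub>i\<^sub>j = (p\<^sub>i - p\<^sub>j) \<bullet> (\<mu>\<^sub>i - \<mu>\<^sub>j)\<close> is supported on the non-edges of \<open>G\<close> and has the form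
  \<open>Q\<^sup>T N + N\<^sup>T Q\<close>, where \<open>Q\<close> is the \<open>(d + 1) \<times> n\<close> matrix of homogeneous coordinates of \<open>p\<close>.
  Suppose that \<open>D \<noteq> 0\<close> has rank \<open>\<rho>\<close>. Being symmetric, \<open>D\<close> has a nonsingular principal submatrix
  on some \<open>\<rho>\<close> rows \<open>S\<close>, and at most \<open>k\<rho> - \<rho>/2\<close> entries of these rows are nonzero up to symmetry.
  Moreover some \<open>r \<ge> \<rho>/2\<close> independent vectors in the row space of \<open>Q\<close> are linear combinations of the
  rows in \<open>S\<close>. Hence all entries of \<open>Q\<close> are rational functions of fewer than \<open>(d + 1) n\<close> numbers,
  which is impossible when they are generic. So every infinitesimal motion of \<open>G\<close> preserves all
  distances to first order.

  For the passage to continuous motions: if \<open>y\<close> has the same edge lengths as \<open>p\<close>, then \<open>p - y\<close> is an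
  infinitesimal motion of the midpoint framework \<open>(p + y)/2\<close>.
\<close>

section \<open>Algebraic independence and the number of parameters\<close>

interpretation ratvs: vector_space "\<lambda>(q::rat) (x::real). of_rat q * x"
  by unfold_locales (simp_all add: algebra_simps of_rat_add of_rat_mult)

text \<open>This is the subfield of the reals generated by \<open>W\<close> over the rationals.
  Since \<open>inverse 0 = 0\<close>, closure under \<open>inverse\<close> needs no side
  condition.\<close>

inductive_set field_gen :: "real set \<Rightarrow> real set" for W where
  incl: "x \<in> W \<Longrightarrow> x \<in> field_gen W"
| rat: "of_rat q \<in> field_gen W"
| add: "x \<in> field_gen W \<Longrightarrow> y \<in> field_gen W \<Longrightarrow> x + y \<in> field_gen W"
| mult: "x \<in> field_gen W \<Longrightarrow> y \<in> field_gen W \<Longrightarrow> x * y \<in> field_gen W"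
| inv: "x \<in> field_gen W \<Longrightarrow> inverse x \<in> field_gen W"

lemma field_gen_0: "0 \<in> field_gen W" and field_gen_1: "1 \<in> field_gen W"
  using field_gen.rat[of 0] field_gen.rat[of 1] by auto

lemma field_gen_minus: "x \<in> field_gen W \<Longrightarrow> - x \<in> field_gen W"
  using field_gen.mult[OF field_gen.rat[of "-1"]] by (fastforce simp: of_rat_minus)

lemma field_gen_diff: "x \<in> field_gen W \<Longrightarrow> y \<in> field_gen W \<Longrightarrow> x - y \<in> field_gen W"
  using field_gen.add[OF _ field_gen_minus] by fastforce

lemma field_gen_divide: "x \<in> field_gen W \<Longrightarrow> y \<in> field_gen W \<Longrightarrow> x / y \<in> field_gen W"
  using field_gen.mult[OF _ field_gen.inv] by (fastforce simp: divide_inverse)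

lemma field_gen_sum: "(\<And>i. i \<in> A \<Longrightarrow> f i \<in> field_gen W) \<Longrightarrow> sum f A \<in> field_gen W"
  by (induction A rule: infinite_finite_induct) (auto intro: field_gen.add field_gen_0)

section \<open>Polynomials and fractions in finitely many reals\<close>

definition monomials :: "real set \<Rightarrow> nat \<Rightarrow> real set" where
  "monomials W e = (\<lambda>u. \<Prod>w\<in>W. w ^ u w) ` (W \<rightarrow>\<^sub>E {..e})"

lemma finite_monomials: "finite W \<Longrightarrow> finite (monomials W e)"
  unfolding monomials_def by (intro finite_imageI finite_PiE) auto

lemma card_monomials: "finite W \<Longrightarrow> card (monomials W e) \<le> (e + 1) ^ card W"
  unfolding monomials_def by (rule order.trans[OF card_image_le]) (auto simp: finite_PiE card_PiE)

lemma monomialsI: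
  assumes "\<And>w. w \<in> W \<Longrightarrow> u w \<le> e"
  shows "(\<Prod>w\<in>W. w ^ u w) \<in> monomials W e"
  unfolding monomials_def using assms
  by (intro image_eqI[where x = "restrict u W"]) (auto intro!: prod.cong)

lemma monomials_mult:
  assumes "x \<in> monomials W d" "y \<in> monomials W e"
  shows "x * y \<in> monomials W (d + e)"
proof -
  obtain u v where u: "u \<in> W \<rightarrow>\<^sub>E {..d}" "x = (\<Prod>w\<in>W. w ^ u w)"
    and v: "v \<in> W \<rightarrow>\<^sub>E {..e}" "y = (\<Prod>w\<in>W. w ^ v w)"
    using assms unfolding monomials_def by blast
  have "x * y = (\<Prod>w\<in>W. w ^ (u w + v w))"
    by (simp add: u v power_add prod.distrib)
  also have "\<dots> \<in> monomials W (d + e)"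
    using u(1) v(1) by (intro monomialsI add_mono) (auto simp: PiE_iff)
  finally show ?thesis .
qed

text \<open>The rational span of \<open>monomials W e\<close> consists of the values at
  \<open>W\<close> of polynomials of degree at most \<open>e\<close> in each variable, and these
  bounds add under products. Bounding each exponent separately makes the number of monomials a plain
  power.\<close>

lemma span_monomials_mult:
  assumes "x \<in> ratvs.span (monomials W d)" "y \<in> ratvs.span (monomials W e)"
  shows "x * y \<in> ratvs.span (monomials W (d + e))"
  using assms(1)
proof (induction rule: ratvs.span_induct_alt)
  case base
  then show ?case by (simp add: ratvs.span_zero)
next
  case (step c x z)
  have "x * y \<in> ratvs.span (monomials W (d + e))"
    using assms(2)
  proof (induction rule: ratvs.span_induct_alt)
    case base
    then show ?case by (simp add: ratvs.span_zero)
  next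
    case (step c' x' z')
    then show ?case
      using ratvs.span_add[OF ratvs.span_scale[OF ratvs.span_base[OF monomials_mult], of x W d x' e c']]
        \<open>x \<in> monomials W d\<close> by (simp add: algebra_simps)
  qed
  then show ?case
    using ratvs.span_add[OF ratvs.span_scale step.IH, of "x * y" c] by (simp add: algebra_simps)
qed

lemma span_monomials_rat: "of_rat q \<in> ratvs.span (monomials W e)"
proof -
  have "(\<Prod>w\<in>W. w ^ (\<lambda>_. 0::nat) w) \<in> monomials W e"
    by (rule monomialsI) simp
  then have "1 \<in> ratvs.span (monomials W e)"
    by (intro ratvs.span_base) simp
  from ratvs.span_scale[OF this, of q] show ?thesis by simp
qed

lemma span_monomials_power:
  assumes "x \<in> ratvs.span (monomials W e)"
  shows "x ^ m \<in> ratvs.span (monomials W (m * e))"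
  using span_monomials_rat[of 1] span_monomials_mult[OF assms]
  by (induction m) (auto)

lemma span_monomials_prod:
  assumes "finite A" "\<And>i. i \<in> A \<Longrightarrow> f i \<in> ratvs.span (monomials W (g i))"
  shows "(\<Prod>i\<in>A. f i) \<in> ratvs.span (monomials W (\<Sum>i\<in>A. g i))"
  using assms
proof (induction A rule: finite_induct)
  case empty
  then show ?case using span_monomials_rat[of 1] by simp
next
  case (insert i A)
  then show ?case by (simp add: span_monomials_mult)
qed

text \<open>Fractions of polynomials in \<open>W\<close> are closed under the field operations, so
  they exhaust the generated field.\<close>

lemma field_gen_quotient:
  assumes "finite W" "x \<in> field_gen W"
  shows "\<exists>e A B. A \<in> ratvs.span (monomials W e) \<and> B \<in> ratvs.span (monomials W e) \<and> B \<noteq> 0 \<and> x = A / B"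
  using assms(2)
proof induction
  case (incl x)
  have "(\<Prod>w\<in>W. w ^ (if w = x then 1 else 0)) = (\<Prod>w\<in>W. if w = x then x else 1)"
    by (intro prod.cong) auto
  also have "\<dots> = x" using incl assms(1) by (simp add: prod.delta)
  finally have "x \<in> monomials W 1" using monomialsI[of W "\<lambda>w. if w = x then 1 else 0" 1] by simp
  then show ?case
    using span_monomials_rat[of 1 W 1] ratvs.span_base by (intro exI[of _ 1] exI[of _ x]) auto
next
  case (rat q)
  show ?case
    using span_monomials_rat[of q W 0] span_monomials_rat[of 1 W 0] by (intro exI[of _ 0] exI[of _ "of_rat q"] exI[of _ 1]) auto
next
  case (add x y)
  then obtain d A B e C D where *: "A \<in> ratvs.span (monomials W d)" "B \<in> ratvs.span (monomials W d)" "B \<noteq> 0" "x = A / B"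
    "C \<in> ratvs.span (monomials W e)" "D \<in> ratvs.span (monomials W e)" "D \<noteq> 0" "y = C / D" by blast
  have "A * D + B * C \<in> ratvs.span (monomials W (d + e))" "B * D \<in> ratvs.span (monomials W (d + e))"
    using * by (auto intro: ratvs.span_add span_monomials_mult)
  moreover have "x + y = (A * D + B * C) / (B * D)" "B * D \<noteq> 0"
    using * by (auto simp: field_simps)
  ultimately show ?case by blast
next
  case (mult x y)
  then obtain d A B e C D where *: "A \<in> ratvs.span (monomials W d)" "B \<in> ratvs.span (monomials W d)" "B \<noteq> 0" "x = A / B"
    "C \<in> ratvs.span (monomials W e)" "D \<in> ratvs.span (monomials W e)" "D \<noteq> 0" "y = C / D" by blast
  have "A * C \<in> ratvs.span (monomials W (d + e))" "B * D \<in> ratvs.span (monomials W (d + e))"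
    using * by (auto intro: span_monomials_mult)
  moreover have "x * y = (A * C) / (B * D)" "B * D \<noteq> 0"
    using * by (auto simp: field_simps)
  ultimately show ?case by blast
next
  case (inv x)
  then obtain d A B where *: "A \<in> ratvs.span (monomials W d)" "B \<in> ratvs.span (monomials W d)" "B \<noteq> 0" "x = A / B"
    by blast
  show ?case
  proof (cases "A = 0")
    \<comment> \<open>With a zero numerator \<open>inverse x\<close> is again 0, so the old fraction
      serves.\<close>
    case True
    then show ?thesis
      using * by (intro exI[of _ d] exI[of _ A] exI[of _ B]) auto
  next
    case False
    then show ?thesis
      using * by (intro exI[of _ d] exI[of _ B] exI[of _ A]) auto
  qed
qed

lemma field_gen_common_denominator:
  assumes "finite W" "finite I" "z ` I \<subseteq> field_gen W"
  shows "\<exists>e A B. B \<in> ratvs.span (monomials W e) \<and> B \<noteq> 0 \<and>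
           (\<forall>i\<in>I. A i \<in> ratvs.span (monomials W e) \<and> z i = A i / B)"
  using assms(2,3)
proof (induction I rule: finite_induct)
  case empty
  then show ?case using span_monomials_rat[of 1 W 0] by (intro exI[of _ 0] exI[of _ undefined] exI[of _ 1]) auto
next
  case (insert j I)
  then obtain e A B where 1: "B \<in> ratvs.span (monomials W e)" "B \<noteq> 0"
    "\<And>i. i \<in> I \<Longrightarrow> A i \<in> ratvs.span (monomials W e) \<and> z i = A i / B"
    by (metis image_insert insert_subset)
  obtain d C D where 2: "C \<in> ratvs.span (monomials W d)" "D \<in> ratvs.span (monomials W d)" "D \<noteq> 0" "z j = C / D"
    using field_gen_quotient[OF assms(1), of "z j"] insert.prems by auto
  define A' where "A' = (\<lambda>i. if i = j then C * B else A i * D)"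
  have "B * D \<in> ratvs.span (monomials W (e + d))" using 1 2 by (intro span_monomials_mult)
  moreover have "A' i \<in> ratvs.span (monomials W (e + d)) \<and> z i = A' i / (B * D)" if "i \<in> insert j I" for i
  proof (cases "i = j")
    case True
    then show ?thesis using 1(1,2) 2 span_monomials_mult[OF 2(1) 1(1)] by (simp add: A'_def add.commute)
  next
    case False
    then show ?thesis using 1(3)[of i] 1(2) 2 that span_monomials_mult[of "A i" W e D d] by (simp add: A'_def)
  qed
  moreover have "B * D \<noteq> 0" using 1(2) 2(3) by simp
  ultimately show ?case by blast
qed

section \<open>Bounding the size of an independent family by counting monomials\<close>

lemma power_count_bound:
  fixes N D M :: nat
  assumes "M < N"
  shows "\<exists>e. (N * e * D + 1) ^ M < (e + 1) ^ N"
proof -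
  \<comment> \<open>The witness equals the constant factor that remains once
    \<open>(e + 1) ^ M\<close> is split off; a single further factor \<open>e + 1\<close> beats
    it.\<close>
  define e where "e = (N * D + 1) ^ M"
  have "(N * e * D + 1) ^ M \<le> ((N * D + 1) * (e + 1)) ^ M"
    by (intro power_mono) (auto simp: algebra_simps)
  also have "\<dots> = e * (e + 1) ^ M" by (simp only: e_def power_mult_distrib)
  also have "\<dots> < (e + 1) ^ Suc M" by simp
  also have "\<dots> \<le> (e + 1) ^ N" using assms by (intro power_increasing) auto
  finally show ?thesis by blast
qed

text \<open>Multiplied by a power of the common denominator \<open>B\<close>, the
  \<open>(e + 1) ^ N\<close> monomials in \<open>z\<close> with exponents at most \<open>e\<close>
  become rationally independent elements of a space spanned by at most
  \<open>(N * e * D + 1) ^ card W\<close> monomials in \<open>W\<close>. If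
  \<open>card W < N\<close>, this fails for suitable \<open>e\<close>.\<close>

lemma alg_indep_card_le:
  assumes z: "alg_indep_Q I z" and "finite I" and W: "finite W" and sub: "z ` I \<subseteq> field_gen W"
  shows "card I \<le> card W"
proof (rule ccontr)
  assume "\<not> card I \<le> card W"
  obtain D A B where B: "B \<in> ratvs.span (monomials W D)" "B \<noteq> 0"
    and A: "\<And>i. i \<in> I \<Longrightarrow> A i \<in> ratvs.span (monomials W D)" "\<And>i. i \<in> I \<Longrightarrow> z i = A i / B"
    using field_gen_common_denominator[OF W \<open>finite I\<close> sub] by metis
  define N where "N = card I"
  obtain e where e: "(N * e * D + 1) ^ card W < (e + 1) ^ N"
    using power_count_bound[of "card W" N D] \<open>\<not> card I \<le> card W\<close> unfolding N_def by auto
  \<comment> \<open>\<open>PiE\<close> functions are undefined outside \<open>I\<close>; the value 0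
    is put there because \<open>alg_indep_Q\<close> requires it of exponent vectors.\<close>
  define M where "M = (\<lambda>u i. if i \<in> I then u i else 0) ` (I \<rightarrow>\<^sub>E {..e})"
  define f where "f = (\<lambda>m. B ^ (N * e) * (\<Prod>i\<in>I. z i ^ m i))"
  have "inj_on (\<lambda>u i. if i \<in> I then u i else (0::nat)) (I \<rightarrow>\<^sub>E {..e})"
    by (rule inj_onI) (rule PiE_ext, auto, metis)
  then have cardM: "card M = (e + 1) ^ N"
    using \<open>finite I\<close> unfolding M_def by (simp add: card_image card_PiE N_def)
  then have finM: "finite M" by (metis card.infinite e not_less_zero)
  have fspan: "f m \<in> ratvs.span (monomials W (N * e * D))" if "m \<in> M" for m
  proof -
    have me: "m i \<le> e" if "i \<in> I" for i using \<open>m \<in> M\<close> that by (auto simp: M_def PiE_iff)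
    \<comment> \<open>Each index receives \<open>B ^ e\<close> out of \<open>B ^ (N * e)\<close>;
      the part \<open>B ^ m i\<close> cancels the denominator of \<open>z i ^ m i\<close> and the
      rest remains.\<close>
    have "(\<Prod>i\<in>I. A i ^ m i * B ^ (e - m i)) = (\<Prod>i\<in>I. B ^ e * z i ^ m i)"
    proof (intro prod.cong refl)
      fix i assume i: "i \<in> I"
      have "B ^ e = B ^ (e - m i) * B ^ m i" using me[OF i] by (simp flip: power_add)
      then show "A i ^ m i * B ^ (e - m i) = B ^ e * z i ^ m i"
        using A(2)[OF i] B(2) by (simp add: power_divide)
    qed
    also have "\<dots> = f m"
      by (simp add: prod.distrib f_def N_def power_mult mult.commute[of "card I"])
    finally have fm: "f m = (\<Prod>i\<in>I. A i ^ m i * B ^ (e - m i))" by simp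
    have "A i ^ m i * B ^ (e - m i) \<in> ratvs.span (monomials W (e * D))" if "i \<in> I" for i
      using span_monomials_mult[OF span_monomials_power[OF A(1)[OF that], of "m i"] span_monomials_power[OF B(1), of "e - m i"]]
        me[OF that] by (simp flip: add_mult_distrib)
    from span_monomials_prod[OF \<open>finite I\<close> this] show ?thesis
      by (simp add: fm N_def mult.assoc)
  qed
  have indep: "\<forall>m\<in>M. a m = 0" if "(\<Sum>m\<in>M. of_rat (a m) * (\<Prod>i\<in>I. z i ^ m i)) = 0" for a
  proof -
    have "\<forall>m\<in>M. \<forall>i. i \<notin> I \<longrightarrow> m i = 0" by (auto simp: M_def)
    then show ?thesis
      using z[unfolded alg_indep_Q_def, THEN conjunct2, rule_format, of I M a] \<open>finite I\<close> finM that by auto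
  qed
  \<comment> \<open>A coincidence of two values would be a relation with coefficients 1 and
    -1.\<close>
  have inj: "inj_on f M"
  proof (rule inj_onI, rule ccontr)
    fix m m' assume m: "m \<in> M" "m' \<in> M" "f m = f m'" "m \<noteq> m'"
    define a where "a = (\<lambda>k. if k = m then 1 else if k = m' then - 1 else (0::rat))"
    have "(\<Sum>k\<in>M. of_rat (a k) * (\<Prod>i\<in>I. z i ^ k i)) = (\<Sum>k\<in>{m, m'}. of_rat (a k) * (\<Prod>i\<in>I. z i ^ k i))"
      using m finM by (intro sum.mono_neutral_right) (auto simp: a_def)
    also have "\<dots> = 0" using m B(2) by (simp add: a_def f_def of_rat_minus)
    finally show False using indep[of a] m by (auto simp: a_def)
  qed
  have "ratvs.independent (f ` M)"
    unfolding ratvs.independent_explicit_module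
  proof (intro allI impI)
    fix t u v assume t: "finite t" "t \<subseteq> f ` M" "(\<Sum>v\<in>t. of_rat (u v) * v) = 0" "v \<in> t"
    define a where "a = (\<lambda>m. if f m \<in> t then u (f m) else 0)"
    have "(\<Sum>m\<in>M. of_rat (a m) * f m) = (\<Sum>v\<in>f ` M. of_rat (if v \<in> t then u v else 0) * v)"
      by (simp add: sum.reindex[OF inj] a_def)
    also have "\<dots> = (\<Sum>v\<in>t. of_rat (u v) * v)"
      using finM t by (intro sum.mono_neutral_cong_right) auto
    finally have "B ^ (N * e) * (\<Sum>m\<in>M. of_rat (a m) * (\<Prod>i\<in>I. z i ^ m i)) = 0"
      using t(3) by (simp add: f_def sum_distrib_left mult_ac)
    then have "\<forall>m\<in>M. a m = 0" using indep B(2) by simp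
    moreover obtain m where "m \<in> M" "v = f m" using t by blast
    ultimately show "u v = 0" using t(4) by (auto simp: a_def split: if_splits)
  qed
  then have "card (f ` M) \<le> card (monomials W (N * e * D))"
    using ratvs.independent_span_bound[OF finite_monomials[OF W], of "f ` M" "N * e * D"] fspan by auto
  then show False
    using card_monomials[OF W, of "N * e * D"] e card_image[OF inj] cardM by simp
qed

section \<open>Transport and extension of independent families\<close>

lemma alg_indep_Q_relation:
  assumes "alg_indep_Q I c" "finite S" "S \<subseteq> I" "finite M" "\<And>m i. m \<in> M \<Longrightarrow> i \<notin> S \<Longrightarrow> m i = 0"
    "(\<Sum>m\<in>M. of_rat (a m) * (\<Prod>i\<in>S. c i ^ m i)) = 0" "m \<in> M"
  shows "a m = 0"
  using assms unfolding alg_indep_Q_def by blast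

lemma alg_indep_Q_reindex:
  assumes f: "inj_on f I" and c: "alg_indep_Q I (c \<circ> f)"
  shows "alg_indep_Q (f ` I) c"
  unfolding alg_indep_Q_def
proof (intro conjI allI impI)
  show "inj_on c (f ` I)"
    using c f unfolding alg_indep_Q_def by (auto simp: inj_on_def)
next
  fix S M and a :: "('b \<Rightarrow> nat) \<Rightarrow> rat"
  assume *: "finite S \<and> S \<subseteq> f ` I \<and> finite M \<and> (\<forall>m\<in>M. \<forall>i. i \<notin> S \<longrightarrow> m i = 0) \<and>
        (\<Sum>m\<in>M. of_rat (a m) * (\<Prod>i\<in>S. c i ^ m i)) = 0"
  define S' where "S' = {i \<in> I. f i \<in> S}"
  have fS': "f ` S' = S" and inj': "inj_on f S'" using * f by (auto simp: S'_def inj_on_def)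
  then have finS': "finite S'" using * finite_imageD by metis
  \<comment> \<open>\<open>f\<close> may send points outside \<open>I\<close> into \<open>S\<close>,
    so the pulled-back exponents are set to 0 off \<open>S'\<close>.\<close>
  define g where "g = (\<lambda>m::'b \<Rightarrow> nat. \<lambda>i. if i \<in> S' then m (f i) else 0)"
  have injg: "inj_on g M"
  proof (rule inj_onI)
    fix m m' assume m: "m \<in> M" "m' \<in> M" "g m = g m'"
    show "m = m'"
    proof
      fix k
      show "m k = m' k"
      proof (cases "k \<in> S")
        case True
        then obtain i where "i \<in> S'" "k = f i" using fS' by blast
        then show ?thesis using fun_cong[OF m(3), of i] by (simp add: g_def)
      next
        case False
        then have "m k = 0" "m' k = 0" using * m(1,2) by blast+
        then show ?thesis by simp
      qed
    qed
  qed
  define a' where "a' = (\<lambda>m. a (inv_into M g m))"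
  have "(\<Sum>m\<in>g ` M. of_rat (a' m) * (\<Prod>i\<in>S'. (c \<circ> f) i ^ m i)) =
        (\<Sum>m\<in>M. of_rat (a m) * (\<Prod>i\<in>S'. (c \<circ> f) i ^ g m i))"
    by (simp add: sum.reindex[OF injg] a'_def injg)
  also have "\<dots> = (\<Sum>m\<in>M. of_rat (a m) * (\<Prod>i\<in>S. c i ^ m i))"
    unfolding fS'[symmetric] prod.reindex[OF inj'] by (auto simp: g_def intro!: sum.cong prod.cong)
  also have "\<dots> = 0" using * by simp
  finally have sum0: "(\<Sum>m\<in>g ` M. of_rat (a' m) * (\<Prod>i\<in>S'. (c \<circ> f) i ^ m i)) = 0" .
  have "a' (g m) = 0" if "m \<in> M" for m
  proof (rule alg_indep_Q_relation[OF c finS' _ _ _ sum0])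
    show "S' \<subseteq> I" "finite (g ` M)" "g m \<in> g ` M" using * that by (auto simp: S'_def)
  qed (auto simp: g_def)
  then show "\<forall>m\<in>M. a m = 0" by (auto simp: a'_def injg)
qed

text \<open>Collected by powers of \<open>x\<close>, the relation is a polynomial in one variable.
  Its coefficient at \<open>x ^ m0 j\<close> is a polynomial in the \<open>z i\<close> with a
  nonzero coefficient, hence nonzero by independence.\<close>

lemma finite_roots_relation:
  fixes z :: "'i \<Rightarrow> real"
  assumes z: "alg_indep_Q I z" and I: "finite I" "j \<notin> I" and M: "finite M"
    and M0: "\<And>m i. m \<in> M \<Longrightarrow> i \<notin> insert j I \<Longrightarrow> m i = 0"
    and a: "m0 \<in> M" "a m0 \<noteq> 0"
  shows "finite {x. (\<Sum>m\<in>M. of_rat (a m) * (x ^ m j * (\<Prod>i\<in>I. z i ^ m i))) = 0}"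
proof -
  define K where "K = Max ((\<lambda>m. m j) ` M)"
  define b where "b = (\<lambda>e. \<Sum>m\<in>{m\<in>M. m j = e}. of_rat (a m) * (\<Prod>i\<in>I. z i ^ m i))"
  have eq: "(\<Sum>m\<in>M. of_rat (a m) * (x ^ m j * (\<Prod>i\<in>I. z i ^ m i))) = (\<Sum>e\<le>K. b e * x ^ e)" for x
  proof -
    have sub: "(\<lambda>m. m j) ` M \<subseteq> {..K}" using M by (auto simp: K_def)
    have "(\<Sum>e\<le>K. b e * x ^ e) = (\<Sum>e\<in>{..K}. \<Sum>m\<in>{m\<in>M. m j = e}. of_rat (a m) * (x ^ m j * (\<Prod>i\<in>I. z i ^ m i)))"
      unfolding b_def sum_distrib_right by (intro sum.cong) (auto simp: mult_ac)
    also have "\<dots> = (\<Sum>m\<in>M. of_rat (a m) * (x ^ m j * (\<Prod>i\<in>I. z i ^ m i)))"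
      using M by (intro sum.group sub) auto
    finally show ?thesis by simp
  qed
  have "b (m0 j) \<noteq> 0"
  proof
    assume b0: "b (m0 j) = 0"
    let ?M = "{m\<in>M. m j = m0 j}"
    let ?g = "\<lambda>m. m(j := 0::nat)"
    \<comment> \<open>All members of \<open>?M\<close> share the exponent \<open>m0 j\<close> at
      \<open>j\<close>, so erasing it loses no information.\<close>
    have inj: "inj_on ?g ?M"
      by (rule inj_onI) (metis (mono_tags, lifting) fun_upd_triv fun_upd_upd mem_Collect_eq)
    define a' where "a' = (\<lambda>m. a (m(j := m0 j)))"
    have "(\<Sum>m\<in>?g ` ?M. of_rat (a' m) * (\<Prod>i\<in>I. z i ^ m i)) = b (m0 j)"
      unfolding b_def sum.reindex[OF inj]
    proof (intro sum.cong refl)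
      fix m assume m: "m \<in> ?M"
      then have "m j = m0 j" by simp
      then have "m(j := m0 j) = m" by (metis fun_upd_triv)
      moreover have "(\<Prod>i\<in>I. z i ^ (m(j := 0)) i) = (\<Prod>i\<in>I. z i ^ m i)"
        using I by (intro prod.cong) auto
      ultimately show "((\<lambda>m. of_rat (a' m) * (\<Prod>i\<in>I. z i ^ m i)) \<circ> ?g) m = of_rat (a m) * (\<Prod>i\<in>I. z i ^ m i)"
        by (simp add: a'_def)
    qed
    then have sum0: "(\<Sum>m\<in>?g ` ?M. of_rat (a' m) * (\<Prod>i\<in>I. z i ^ m i)) = 0"
      using b0 by simp
    have "a' (?g m0) = 0"
    proof (rule alg_indep_Q_relation[OF z I(1) subset_refl _ _ sum0])
      show "?g m0 \<in> ?g ` ?M" using a by blast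
    qed (use M M0 in auto)
    then show False using a by (simp add: a'_def)
  qed
  moreover have "m0 j \<le> K" using M a by (auto simp: K_def)
  ultimately have "finite {x. (\<Sum>e\<le>K. b e * x ^ e) = 0}"
    unfolding polyfun_finite_roots by blast
  then show ?thesis unfolding eq .
qed

text \<open>There are countably many polynomial relations with rational coefficients, each excludes
  only finitely many values of the new element, and the reals are uncountable.\<close>

lemma alg_indep_Q_extend:
  fixes z :: "'i \<Rightarrow> real"
  assumes z: "alg_indep_Q I z" and I: "finite I" "j \<notin> I"
  shows "\<exists>x. alg_indep_Q (insert j I) (z(j := x))"
proof -
  define Ex where "Ex = (\<lambda>u i. if i \<in> insert j I then u i else 0) ` (insert j I \<rightarrow>\<^sub>E (UNIV :: nat set))"
  have "countable Ex"
    unfolding Ex_def using I by (intro countable_image countable_PiE) auto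
  have Ex: "m \<in> Ex" if "\<And>i. i \<notin> insert j I \<Longrightarrow> m i = 0" for m
    unfolding Ex_def using that
    by (intro image_eqI[where x = "restrict m (insert j I)"]) auto
  \<comment> \<open>A relation is encoded as a finite set of pairs of an exponent vector and a
    nonzero coefficient; injectivity of \<open>fst\<close> gives each vector one
    coefficient.\<close>
  define \<R> where "\<R> = {R. R \<subseteq> Ex \<times> (UNIV - {0 :: rat}) \<and> finite R \<and> R \<noteq> {} \<and> inj_on fst R}"
  define bad where "bad = (\<lambda>R. {x. (\<Sum>p\<in>R. of_rat (snd p) * (x ^ fst p j * (\<Prod>i\<in>I. z i ^ fst p i))) = 0})"
  have "countable {R. R \<subseteq> Ex \<times> (UNIV - {0 :: rat}) \<and> finite R}"
    using countable_Collect_finite_subset[of "Ex \<times> (UNIV - {0 :: rat})"] \<open>countable Ex\<close> by (simp add: conj_commute)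
  then have "countable \<R>" by (rule countable_subset[rotated]) (auto simp: \<R>_def)
  moreover have "countable (bad R)" if R: "R \<in> \<R>" for R
  proof -
    have inj: "inj_on fst R" and finR: "finite R" using R by (auto simp: \<R>_def)
    define a where "a = (\<lambda>m. snd (inv_into R fst m))"
    obtain p where p: "p \<in> R" using R by (auto simp: \<R>_def)
    have "bad R = {x. (\<Sum>m\<in>fst ` R. of_rat (a m) * (x ^ m j * (\<Prod>i\<in>I. z i ^ m i))) = 0}"
      unfolding bad_def sum.reindex[OF inj] a_def by (simp add: inj cong: sum.cong)
    also have "finite \<dots>"
    proof (rule finite_roots_relation[OF z I])
      show "finite (fst ` R)" "fst p \<in> fst ` R" using finR p by auto
      show "a (fst p) \<noteq> 0" using p R by (auto simp: a_def inj \<R>_def)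
      show "m i = 0" if "m \<in> fst ` R" "i \<notin> insert j I" for m i
        using that R by (auto simp: \<R>_def Ex_def)
    qed
    finally show ?thesis by (rule countable_finite)
  qed
  ultimately have "countable (\<Union>R\<in>\<R>. bad R)"
    by (intro countable_UN)
  \<comment> \<open>Avoiding the old values as well keeps the extended family injective, as
    \<open>alg_indep_Q\<close> demands.\<close>
  then have "countable (z ` I \<union> (\<Union>R\<in>\<R>. bad R))"
    using I by (simp add: countable_finite)
  then have "z ` I \<union> (\<Union>R\<in>\<R>. bad R) \<noteq> UNIV"
    using uncountable_UNIV_real by metis
  then obtain x where x: "x \<notin> z ` I" "\<And>R. R \<in> \<R> \<Longrightarrow> x \<notin> bad R"
    by blast
  have "alg_indep_Q (insert j I) (z(j := x))"
    unfolding alg_indep_Q_def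
  proof (intro conjI allI impI)
    show "inj_on (z(j := x)) (insert j I)"
      using z I x(1) unfolding alg_indep_Q_def by (auto simp: inj_on_def)
  next
    fix S M and a :: "('i \<Rightarrow> nat) \<Rightarrow> rat"
    assume *: "finite S \<and> S \<subseteq> insert j I \<and> finite M \<and> (\<forall>m\<in>M. \<forall>i. i \<notin> S \<longrightarrow> m i = 0) \<and>
        (\<Sum>m\<in>M. of_rat (a m) * (\<Prod>i\<in>S. (z(j := x)) i ^ m i)) = 0"
    show "\<forall>m\<in>M. a m = 0"
    proof (rule ccontr)
      assume ne: "\<not> ?thesis"
      define R where "R = (\<lambda>m. (m, a m)) ` {m\<in>M. a m \<noteq> 0}"
      have injR: "inj_on (\<lambda>m. (m, a m)) {m\<in>M. a m \<noteq> 0}" by (auto simp: inj_on_def)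
      have "m \<in> Ex" if "m \<in> M" for m using * that by (intro Ex) blast
      then have "R \<in> \<R>"
        using * ne by (auto simp: \<R>_def R_def inj_on_def)
      moreover have "x \<in> bad R"
      proof -
        have "(\<Sum>p\<in>R. of_rat (snd p) * (x ^ fst p j * (\<Prod>i\<in>I. z i ^ fst p i))) =
          (\<Sum>m\<in>{m\<in>M. a m \<noteq> 0}. of_rat (a m) * (x ^ m j * (\<Prod>i\<in>I. z i ^ m i)))"
          unfolding R_def sum.reindex[OF injR] by simp
        also have "\<dots> = (\<Sum>m\<in>M. of_rat (a m) * (x ^ m j * (\<Prod>i\<in>I. z i ^ m i)))"
          using * by (intro sum.mono_neutral_left) auto
        also have "\<dots> = (\<Sum>m\<in>M. of_rat (a m) * (\<Prod>i\<in>S. (z(j := x)) i ^ m i))"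
        proof (intro sum.cong refl arg_cong2[where f = "(*)"])
          fix m assume m: "m \<in> M"
          have "(\<Prod>i\<in>S. (z(j := x)) i ^ m i) = (\<Prod>i\<in>insert j I. (z(j := x)) i ^ m i)"
            using * m I by (intro prod.mono_neutral_left) auto
          also have "\<dots> = x ^ m j * (\<Prod>i\<in>I. (z(j := x)) i ^ m i)"
            using I by simp
          also have "(\<Prod>i\<in>I. (z(j := x)) i ^ m i) = (\<Prod>i\<in>I. z i ^ m i)"
            using I by (intro prod.cong) auto
          finally show "x ^ m j * (\<Prod>i\<in>I. z i ^ m i) = (\<Prod>i\<in>S. (z(j := x)) i ^ m i)" by simp
        qed
        finally show ?thesis using * by (simp add: bad_def)
      qed
      ultimately show False using x(2) by blast
    qed
  qed
  then show ?thesis ..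
qed

lemma alg_indep_Q_extend_finite:
  fixes z :: "'i \<Rightarrow> real"
  assumes "alg_indep_Q I z" "finite I" "finite J" "I \<inter> J = {}"
  shows "\<exists>z'. (\<forall>i\<in>I. z' i = z i) \<and> alg_indep_Q (I \<union> J) z'"
  using assms(3,4)
proof (induction J rule: finite_induct)
  case empty
  then show ?case using assms by auto
next
  case (insert j J)
  then obtain z' where z': "\<forall>i\<in>I. z' i = z i" "alg_indep_Q (I \<union> J) z'" by auto
  obtain x where "alg_indep_Q (insert j (I \<union> J)) (z'(j := x))"
    using alg_indep_Q_extend[OF z'(2), of j] insert assms by auto
  moreover have "\<forall>i\<in>I. (z'(j := x)) i = z i" using z'(1) insert.prems by auto
  ultimately show ?case by (intro exI[of _ "z'(j := x)"]) (simp del: fun_upd_apply)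
qed

section \<open>Symmetric matrices vanishing on edges\<close>

lemma sum_diff_scaled:
  fixes a b :: "'s \<Rightarrow> real"
  shows "(\<Sum>s\<in>S. (a s - c * b s) * x s) = (\<Sum>s\<in>S. a s * x s) - c * (\<Sum>s\<in>S. b s * x s)"
  unfolding sum_distrib_left sum_subtractf[symmetric] by (intro sum.cong) (auto simp: algebra_simps)

lemma sum_mult_indicator:
  fixes f :: "'s \<Rightarrow> real"
  assumes "finite S" "t \<in> S"
  shows "(\<Sum>s\<in>S. f s * (if s = t then 1 else 0)) = f t"
proof -
  have "(\<Sum>s\<in>S. f s * (if s = t then 1 else 0)) = (\<Sum>s\<in>S. if s = t then f s else 0)"
    by (intro sum.cong) auto
  then show ?thesis using assms by simp
qed

lemma sum_linear_combination:
  fixes a :: "'t \<Rightarrow> real"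
  shows "(\<Sum>i\<in>V. (\<Sum>s\<in>S. a s * h s i) * x i) = (\<Sum>s\<in>S. a s * (\<Sum>i\<in>V. h s i * x i))"
  unfolding sum_distrib_left sum_distrib_right by (subst sum.swap) (simp add: mult_ac)

text \<open>Gaussian elimination, one equation per induction step: \<open>A'\<close> arises by
  solving equation \<open>t\<close> for the unknown \<open>s0\<close>, and \<open>w\<close> restores
  that unknown by back substitution.\<close>

lemma homogeneous_system_nontrivial:
  fixes A :: "'t \<Rightarrow> 's \<Rightarrow> real"
  assumes "finite T" "finite S" "card T < card S"
  shows "\<exists>y. (\<exists>s\<in>S. y s \<noteq> 0) \<and> (\<forall>t\<in>T. (\<Sum>s\<in>S. A t s * y s) = 0)"
  using assms
proof (induction T arbitrary: S A rule: finite_induct)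
  case empty
  then obtain s where "s \<in> S" by (metis card.empty equals0I less_irrefl)
  then show ?case by (intro exI[of _ "\<lambda>_. 1"]) auto
next
  case (insert t T)
  show ?case
  proof (cases "\<forall>s\<in>S. A t s = 0")
    case True
    have "card T < card S" using insert by simp
    with insert.IH[of S A] insert.prems(1) True show ?thesis by auto
  next
    case False
    then obtain s0 where s0: "s0 \<in> S" "A t s0 \<noteq> 0" by blast
    define A' where "A' = (\<lambda>t' s. A t' s - A t' s0 * A t s / A t s0)"
    have "card T < card (S - {s0})" using insert s0 by simp
    then obtain y where y: "\<exists>s\<in>S - {s0}. y s \<noteq> 0" "\<And>t'. t' \<in> T \<Longrightarrow> (\<Sum>s\<in>S - {s0}. A' t' s * y s) = 0"
      using insert.IH[of "S - {s0}" A'] insert.prems(1) by auto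
    define w where "w = y(s0 := - (\<Sum>s\<in>S - {s0}. A t s * y s) / A t s0)"
    have split: "(\<Sum>s\<in>S. A t' s * w s) = A t' s0 * w s0 + (\<Sum>s\<in>S - {s0}. A t' s * y s)" for t'
      using s0 insert.prems(1) by (auto simp: sum.remove w_def intro!: sum.cong)
    have "(\<Sum>s\<in>S. A t s * w s) = 0" unfolding split using s0 by (simp add: w_def)
    moreover have "(\<Sum>s\<in>S. A t' s * w s) = 0" if "t' \<in> T" for t'
    proof -
      have "(\<Sum>s\<in>S - {s0}. A' t' s * y s) =
          (\<Sum>s\<in>S - {s0}. A t' s * y s) - A t' s0 / A t s0 * (\<Sum>s\<in>S - {s0}. A t s * y s)"
        using sum_diff_scaled[of "A t'" "A t' s0 / A t s0" "A t" y "S - {s0}"] by (simp add: A'_def)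
      then show ?thesis unfolding split using y(2)[OF that] s0 by (simp add: w_def)
    qed
    moreover have "\<exists>s\<in>S. w s \<noteq> 0" using y(1) by (auto simp: w_def)
    ultimately show ?thesis by (intro exI[of _ w]) auto
  qed
qed

text \<open>Induction on the rows. If some \<open>x0\<close> is killed by the rows in
  \<open>S\<close> but not by row \<open>t\<close>, it determines the multiple of row
  \<open>t\<close> to subtract from \<open>f\<close>; otherwise row \<open>t\<close> imposes no new
  condition.\<close>

lemma in_span_if_vanishes_on_kernel:
  fixes D :: "'s \<Rightarrow> 'v \<Rightarrow> real"
  assumes "finite S" "finite V"
    and "\<And>x. (\<And>s. s \<in> S \<Longrightarrow> (\<Sum>i\<in>V. D s i * x i) = 0) \<Longrightarrow> (\<Sum>i\<in>V. f i * x i) = 0"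
  shows "\<exists>y. \<forall>i\<in>V. f i = (\<Sum>s\<in>S. y s * D s i)"
  using assms(1,3)
proof (induction S arbitrary: f rule: finite_induct)
  case empty
  have "f i = 0" if "i \<in> V" for i
  proof -
    have "(\<Sum>j\<in>V. f j * (if j = i then 1 else 0)) = f i"
      using that assms(2) by (rule sum_mult_indicator[rotated])
    then show ?thesis using empty[of "\<lambda>j. if j = i then 1 else 0"] by simp
  qed
  then show ?case by simp
next
  case (insert t S)
  show ?case
  proof (cases "\<exists>x0. (\<forall>s\<in>S. (\<Sum>i\<in>V. D s i * x0 i) = 0) \<and> (\<Sum>i\<in>V. D t i * x0 i) \<noteq> 0")
    case True
    then obtain x0 where x0: "\<And>s. s \<in> S \<Longrightarrow> (\<Sum>i\<in>V. D s i * x0 i) = 0"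
      and nz: "(\<Sum>i\<in>V. D t i * x0 i) \<noteq> 0" by blast
    define c where "c = (\<Sum>i\<in>V. f i * x0 i) / (\<Sum>i\<in>V. D t i * x0 i)"
    have "\<exists>y. \<forall>i\<in>V. f i - c * D t i = (\<Sum>s\<in>S. y s * D s i)"
    proof (rule insert.IH)
      fix x assume x: "\<And>s. s \<in> S \<Longrightarrow> (\<Sum>i\<in>V. D s i * x i) = 0"
      \<comment> \<open>Subtracting \<open>b\<close> times \<open>x0\<close> moves \<open>x\<close>
        into the kernel of row \<open>t\<close> without disturbing the rows in
        \<open>S\<close>.\<close>
      define b where "b = (\<Sum>i\<in>V. D t i * x i) / (\<Sum>i\<in>V. D t i * x0 i)"
      have lin: "(\<Sum>i\<in>V. h i * (x i - b * x0 i)) = (\<Sum>i\<in>V. h i * x i) - b * (\<Sum>i\<in>V. h i * x0 i)" for h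
        using sum_diff_scaled[of x b x0 h V] by (simp add: mult.commute)
      have "(\<Sum>i\<in>V. f i * (x i - b * x0 i)) = 0"
      proof (rule insert.prems)
        fix s assume "s \<in> insert t S"
        then show "(\<Sum>i\<in>V. D s i * (x i - b * x0 i)) = 0"
          using nz x x0 unfolding lin by (auto simp: b_def)
      qed
      then have "(\<Sum>i\<in>V. f i * x i) = b * (\<Sum>i\<in>V. f i * x0 i)" by (simp add: lin)
      also have "\<dots> = c * (\<Sum>i\<in>V. D t i * x i)" by (simp add: b_def c_def)
      finally show "(\<Sum>i\<in>V. (f i - c * D t i) * x i) = 0"
        using sum_diff_scaled[of f c "D t" x V] by simp
    qed
    then obtain y where y: "\<forall>i\<in>V. f i - c * D t i = (\<Sum>s\<in>S. y s * D s i)" by blast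
    have "f i = (\<Sum>s\<in>insert t S. (y(t := c)) s * D s i)" if "i \<in> V" for i
    proof -
      have "(\<Sum>s\<in>S. (y(t := c)) s * D s i) = (\<Sum>s\<in>S. y s * D s i)"
        using insert.hyps by (intro sum.cong) auto
      then show ?thesis using y that insert.hyps by (simp add: algebra_simps)
    qed
    then show ?thesis by blast
  next
    case False
    then have "\<exists>y. \<forall>i\<in>V. f i = (\<Sum>s\<in>S. y s * D s i)"
      by (intro insert.IH insert.prems) auto
    then obtain y where y: "\<forall>i\<in>V. f i = (\<Sum>s\<in>S. y s * D s i)" by blast
    have "f i = (\<Sum>s\<in>insert t S. (y(t := 0)) s * D s i)" if "i \<in> V" for i
    proof -
      have "(\<Sum>s\<in>S. (y(t := 0)) s * D s i) = (\<Sum>s\<in>S. y s * D s i)"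
        using insert.hyps by (intro sum.cong) auto
      then show ?thesis using y that insert.hyps by simp
    qed
    then show ?thesis by blast
  qed
qed

text \<open>A smallest set of rows with the same common kernel is independent. If row
  \<open>s\<close> vanished on \<open>S\<close>, then by symmetry the indicator of \<open>s\<close>
  would be killed by the rows in \<open>S\<close>, hence by all rows; column \<open>s\<close>, and
  with it row \<open>s\<close>, would be zero, against independence.\<close>

lemma symmetric_row_basis:
  fixes D :: "'v \<Rightarrow> 'v \<Rightarrow> real"
  assumes V: "finite V" and sym: "\<And>i j. i \<in> V \<Longrightarrow> j \<in> V \<Longrightarrow> D i j = D j i"
  shows "\<exists>S\<subseteq>V. (\<forall>x. (\<forall>s\<in>S. (\<Sum>i\<in>V. D s i * x i) = 0) \<longrightarrow> (\<forall>j\<in>V. (\<Sum>i\<in>V. D j i * x i) = 0)) \<and>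
    (\<forall>y. (\<forall>i\<in>V. (\<Sum>s\<in>S. y s * D s i) = 0) \<longrightarrow> (\<forall>s\<in>S. y s = 0)) \<and>
    (\<forall>s\<in>S. \<exists>s'\<in>S. D s s' \<noteq> 0)"
proof -
  define gen where "gen = (\<lambda>S. S \<subseteq> V \<and> (\<forall>x. (\<forall>s\<in>S. (\<Sum>i\<in>V. D s i * x i) = 0) \<longrightarrow> (\<forall>j\<in>V. (\<Sum>i\<in>V. D j i * x i) = 0)))"
  have "gen V" by (auto simp: gen_def)
  then obtain S where S: "gen S" and min: "\<And>S'. gen S' \<Longrightarrow> card S \<le> card S'"
    using ex_has_least_nat[of gen V card] by blast
  have SV: "S \<subseteq> V" and finS: "finite S" using S V finite_subset by (auto simp: gen_def)
  have ker: "(\<Sum>i\<in>V. D j i * x i) = 0" if "\<And>s. s \<in> S \<Longrightarrow> (\<Sum>i\<in>V. D s i * x i) = 0" "j \<in> V" for x j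
    using S that unfolding gen_def by blast
  have indep: "y s0 = 0" if y: "\<And>i. i \<in> V \<Longrightarrow> (\<Sum>s\<in>S. y s * D s i) = 0" and s0: "s0 \<in> S" for y s0
  proof (rule ccontr)
    assume nz: "y s0 \<noteq> 0"
    have "gen (S - {s0})"
      unfolding gen_def
    proof (intro conjI allI impI)
      show "S - {s0} \<subseteq> V" using SV by blast
      fix x assume x: "\<forall>s\<in>S - {s0}. (\<Sum>i\<in>V. D s i * x i) = 0"
      have "0 = (\<Sum>i\<in>V. (\<Sum>s\<in>S. y s * D s i) * x i)" using y by simp
      also have "\<dots> = (\<Sum>s\<in>S. y s * (\<Sum>i\<in>V. D s i * x i))"
        by (rule sum_linear_combination)
      also have "\<dots> = y s0 * (\<Sum>i\<in>V. D s0 i * x i)"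
        using x by (subst sum.remove[OF finS s0]) simp
      finally have "(\<Sum>i\<in>V. D s0 i * x i) = 0" using nz by simp
      with x have "(\<Sum>i\<in>V. D s i * x i) = 0" if "s \<in> S" for s using that by (cases "s = s0") auto
      then show "\<forall>j\<in>V. (\<Sum>i\<in>V. D j i * x i) = 0" using ker by blast
    qed
    from min[OF this] card_Diff1_less[OF finS s0] show False by simp
  qed
  have "\<exists>s'\<in>S. D s s' \<noteq> 0" if s: "s \<in> S" for s
  proof (rule ccontr)
    assume *: "\<not> ?thesis"
    have delta: "(\<Sum>i\<in>V. D j i * (if i = s then 1 else 0)) = D j s" for j
      using s SV V by (intro sum_mult_indicator) auto
    have z: "D j s = 0" if "j \<in> V" for j
    proof -
      have "(\<Sum>i\<in>V. D j i * (if i = s then 1 else 0)) = 0"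
      proof (rule ker[OF _ that])
        fix s' assume s': "s' \<in> S"
        then have "D s' s = D s s'" using s SV by (intro sym) auto
        then show "(\<Sum>i\<in>V. D s' i * (if i = s then 1 else 0)) = 0" unfolding delta using * s' by simp
      qed
      then show ?thesis unfolding delta .
    qed
    \<comment> \<open>The zero row \<open>s\<close> is itself a relation, with coefficient 1 at
      \<open>s\<close>, among the rows in \<open>S\<close>.\<close>
    have "(if s = s then 1 else 0) = (0::real)"
    proof (rule indep[of "\<lambda>t. if t = s then 1 else 0" s])
      fix i assume "i \<in> V"
      have "(\<Sum>t\<in>S. (if t = s then 1 else 0) * D t i) = D s i"
        using sum_mult_indicator[OF finS s, of "\<lambda>t. D t i"] by (simp add: mult.commute)
      also have "\<dots> = D i s" using \<open>i \<in> V\<close> s SV by (intro sym) auto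
      finally show "(\<Sum>t\<in>S. (if t = s then 1 else 0) * D t i) = 0" using z[OF \<open>i \<in> V\<close>] by simp
    qed (use s in auto)
    then show False by simp
  qed
  with SV ker indep show ?thesis by (intro exI[of _ S]) blast
qed

text \<open>At most \<open>k * card S\<close> pairs start in \<open>S\<close>. Those staying inside
  \<open>S\<close> occur in both orientations, and \<open>nbr\<close> provides at least
  \<open>card S\<close> of them, so keeping one orientation of each saves at least half of
  \<open>card S\<close>.\<close>

lemma edge_representatives:
  fixes R :: "'v \<Rightarrow> 'v \<Rightarrow> bool"
  assumes V: "finite V" and SV: "S \<subseteq> V" and sym: "\<And>i j. i \<in> V \<Longrightarrow> j \<in> V \<Longrightarrow> R i j \<Longrightarrow> R j i"
    and irr: "\<And>i. i \<in> V \<Longrightarrow> \<not> R i i"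
    and deg: "\<And>i. i \<in> V \<Longrightarrow> card {j\<in>V. R i j} \<le> k"
    and nbr: "\<And>s. s \<in> S \<Longrightarrow> \<exists>s'\<in>S. R s s'"
  shows "\<exists>T\<subseteq>S \<times> V. 2 * card T + card S \<le> 2 * k * card S \<and>
    (\<forall>s\<in>S. \<forall>i\<in>V. R s i \<longrightarrow> (s, i) \<in> T \<or> (i, s) \<in> T)"
proof -
  have finS: "finite S" using V SV finite_subset by blast
  \<comment> \<open>The injection \<open>h\<close> serves as an arbitrary linear order that selects
    an orientation.\<close>
  obtain h :: "'v \<Rightarrow> nat" where h: "inj_on h V" using finite_imp_inj_to_nat_seg[OF V] by blast
  define X where "X = (SIGMA s:S. {i\<in>V. R s i})"
  define X0 where "X0 = {(s, i) \<in> X. i \<notin> S}"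
  define X1 where "X1 = {(s, i) \<in> X. i \<in> S \<and> h s < h i}"
  define X2 where "X2 = {(s, i) \<in> X. i \<in> S \<and> h i < h s}"
  have "finite X" unfolding X_def using finS V by auto
  then have fin: "finite X0" "finite X1" "finite X2" by (auto simp: X0_def X1_def X2_def intro: finite_subset)
  have ne: "h s \<noteq> h i" if "(s, i) \<in> X" for s i
    using that h irr SV by (auto simp: X_def inj_on_def)
  then have X: "X = X0 \<union> (X1 \<union> X2)"
    by (auto simp: X0_def X1_def X2_def neq_iff)
  have "X2 = prod.swap ` X1"
    using sym SV by (fastforce simp: X1_def X2_def X_def image_iff)
  then have c12: "card X2 = card X1" by (simp add: card_image)
  have cX: "card X = card X0 + 2 * card X1"
    unfolding X using fin c12
    by (subst card_Un_disjoint; auto simp: X0_def X1_def X2_def card_Un_disjoint disjoint_iff)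
  have "card X = (\<Sum>s\<in>S. card {i\<in>V. R s i})" unfolding X_def using finS V by simp
  also have "\<dots> \<le> (\<Sum>s\<in>S. k)" using deg SV by (intro sum_mono) auto
  finally have le: "card X \<le> k * card S" by (simp add: mult.commute)
  have "card S = (\<Sum>s\<in>S. 1)" by simp
  also have "\<dots> \<le> (\<Sum>s\<in>S. card {i\<in>S. R s i})"
    using nbr finS by (intro sum_mono) (auto simp: Suc_le_eq card_gt_0_iff)
  also have "\<dots> = card (SIGMA s:S. {i\<in>S. R s i})" using finS by simp
  also have "(SIGMA s:S. {i\<in>S. R s i}) = X1 \<union> X2"
    using SV ne by (auto simp: X1_def X2_def X_def neq_iff)
  also have "card (X1 \<union> X2) = 2 * card X1"
    using fin c12 by (subst card_Un_disjoint) (auto simp: X1_def X2_def)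
  finally have ge: "card S \<le> 2 * card X1" .
  have "card (X0 \<union> X1) = card X0 + card X1"
    using fin by (intro card_Un_disjoint) (auto simp: X0_def X1_def)
  with cX le ge have "2 * card (X0 \<union> X1) + card S \<le> 2 * k * card S" by linarith
  moreover have "X0 \<union> X1 \<subseteq> S \<times> V" by (auto simp: X0_def X1_def X_def)
  moreover have "(s, i) \<in> X0 \<union> X1 \<or> (i, s) \<in> X0 \<union> X1" if "s \<in> S" "i \<in> V" "R s i" for s i
  proof -
    have "(s, i) \<in> X" using that by (simp add: X_def)
    moreover have "(i, s) \<in> X" if "i \<in> S" using that \<open>s \<in> S\<close> \<open>R s i\<close> \<open>i \<in> V\<close> sym SV by (auto simp: X_def)
    ultimately show ?thesis using ne[of s i] that(1) by (auto simp: X0_def X1_def)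
  qed
  ultimately show ?thesis by (intro exI[of _ "X0 \<union> X1"]) blast
qed

section \<open>Decompositions into few symmetric products\<close>

text \<open>
  The rows \<open>pivot_row Q C B c\<close> (\<open>c \<in> C\<close>) are vectors of the row space of \<open>Q\<close> in reduced echelon form
  with pivot set \<open>C\<close>; this form is preserved when \<open>C\<close> shrinks in \<open>pivot_elimination\<close>.
\<close>

definition pivot_row :: "('c::finite \<Rightarrow> 'v \<Rightarrow> real) \<Rightarrow> 'c set \<Rightarrow> ('c \<Rightarrow> 'c \<Rightarrow> real) \<Rightarrow> 'c \<Rightarrow> 'v \<Rightarrow> real" where
  "pivot_row Q C B c i = Q c i + (\<Sum>c'\<in>- C. B c c' * Q c' i)"

text \<open>As a matrix this is \<open>F^T G + G^T F\<close>, with the rows of \<open>F\<close> and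
  \<open>G\<close> indexed by \<open>C\<close>; its rank is at most \<open>2 * card C\<close> for
  finite \<open>C\<close>.\<close>

definition sym_prod_sum :: "'c set \<Rightarrow> ('c \<Rightarrow> 'v \<Rightarrow> real) \<Rightarrow> ('c \<Rightarrow> 'v \<Rightarrow> real) \<Rightarrow> 'v \<Rightarrow> 'v \<Rightarrow> real" where
  "sym_prod_sum C f g i j = (\<Sum>c\<in>C. f c i * g c j + g c i * f c j)"

text \<open>Multiples of \<open>f c1\<close> are subtracted so that every other row kills
  \<open>x\<close>. Applying \<open>D\<close> to \<open>x\<close> then forces the partner
  \<open>gt\<close> of \<open>f c1\<close> to be a combination of the remaining \<open>f' c\<close>,
  so the product of \<open>f c1\<close> and \<open>gt\<close> can be absorbed into the other
  products.\<close>

lemma pivot_elimination: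
  fixes Q :: "'c::finite \<Rightarrow> 'v \<Rightarrow> real" and x :: "'v \<Rightarrow> real"
  assumes V: "finite V"
    and D: "\<And>i j. i \<in> V \<Longrightarrow> j \<in> V \<Longrightarrow> D i j = sym_prod_sum C (pivot_row Q C B) g i j"
    and c1: "c1 \<in> C"
    and x: "\<And>i. i \<in> V \<Longrightarrow> (\<Sum>j\<in>V. D i j * x j) = 0"
    and nz: "(\<Sum>j\<in>V. pivot_row Q C B c1 j * x j) \<noteq> 0"
  shows "\<exists>B' g'. \<forall>i\<in>V. \<forall>j\<in>V. D i j = sym_prod_sum (C - {c1}) (pivot_row Q (C - {c1}) B') g' i j"
proof -
  define f where "f = pivot_row Q C B"
  define C' where "C' = C - {c1}"
  define dot where "dot = (\<lambda>h. \<Sum>j\<in>V. h j * x j)"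
  define F where "F = dot (f c1)"
  have F: "F \<noteq> 0" using nz by (simp add: F_def dot_def f_def)
  define \<alpha> where "\<alpha> = (\<lambda>c. dot (f c) / F)"
  \<comment> \<open>Index \<open>c1\<close> becomes a non-pivot, so \<open>Q c1\<close> enters row
    \<open>c\<close> with coefficient \<open>- \<alpha> c\<close> and the old entries are corrected
    accordingly.\<close>
  define B' where "B' = (\<lambda>c c'. if c' = c1 then - \<alpha> c else B c c' - \<alpha> c * B c1 c')"
  define f' where "f' = (\<lambda>c i. f c i - \<alpha> c * f c1 i)"
  define g' where "g' = (\<lambda>c i. g c i - dot (g c) / F * f c1 i)"
  define gt where "gt = (\<lambda>i. g c1 i + (\<Sum>c\<in>C'. \<alpha> c * g c i))"
  have dot: "dot h = (\<Sum>j\<in>V. h j * x j)" for h by (simp add: dot_def)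
  have dot_diff: "dot (\<lambda>i. a i - b * c i) = dot a - b * dot c" for a b c
    by (simp add: dot_def sum_diff_scaled)
  have piv: "pivot_row Q C' B' c = f' c" for c
  proof
    fix i
    have "- C' = insert c1 (- C)" using c1 by (auto simp: C'_def)
    then have "pivot_row Q C' B' c i = Q c i - \<alpha> c * Q c1 i + (\<Sum>c'\<in>- C. B' c c' * Q c' i)"
      using c1 by (simp add: pivot_row_def B'_def)
    also have "(\<Sum>c'\<in>- C. B' c c' * Q c' i) = (\<Sum>c'\<in>- C. B c c' * Q c' i - \<alpha> c * (B c1 c' * Q c' i))"
      using c1 by (intro sum.cong) (auto simp: B'_def algebra_simps)
    also have "\<dots> = (\<Sum>c'\<in>- C. B c c' * Q c' i) - \<alpha> c * (\<Sum>c'\<in>- C. B c1 c' * Q c' i)"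
      by (simp add: sum_subtractf sum_distrib_left)
    finally show "pivot_row Q C' B' c i = f' c i"
      by (simp add: f'_def f_def pivot_row_def algebra_simps)
  qed
  have f'0: "dot (f' c) = 0" for c
    using F unfolding f'_def dot_diff \<alpha>_def F_def[symmetric] by simp
  have C: "C = insert c1 C'" "c1 \<notin> C'" using c1 by (auto simp: C'_def)
  have D1: "D i j = (\<Sum>c\<in>C'. f' c i * g c j + g c i * f' c j) + f c1 i * gt j + gt i * f c1 j"
    if "i \<in> V" "j \<in> V" for i j
  proof -
    have "D i j = f c1 i * g c1 j + g c1 i * f c1 j + (\<Sum>c\<in>C'. f c i * g c j + g c i * f c j)"
      using D[OF that] C by (simp add: sym_prod_sum_def f_def)
    also have "(\<Sum>c\<in>C'. f c i * g c j + g c i * f c j) =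
       (\<Sum>c\<in>C'. (f' c i * g c j + g c i * f' c j) + (f c1 i * (\<alpha> c * g c j) + (\<alpha> c * g c i) * f c1 j))"
      by (intro sum.cong) (auto simp: f'_def algebra_simps)
    also have "\<dots> = (\<Sum>c\<in>C'. f' c i * g c j + g c i * f' c j) +
       (f c1 i * (\<Sum>c\<in>C'. \<alpha> c * g c j) + (\<Sum>c\<in>C'. \<alpha> c * g c i) * f c1 j)"
      by (simp only: sum.distrib sum_distrib_left sum_distrib_right)
    finally show ?thesis by (simp add: gt_def algebra_simps)
  qed
  have D2: "(\<Sum>c\<in>C'. f' c i * dot (g c)) + f c1 i * dot gt + gt i * F = 0" if i: "i \<in> V" for i
  proof -
    have "0 = (\<Sum>j\<in>V. D i j * x j)" using x[OF i] by simp
    also have "\<dots> = (\<Sum>j\<in>V. (\<Sum>c\<in>C'. f' c i * g c j) * x j) + (\<Sum>j\<in>V. (\<Sum>c\<in>C'. g c i * f' c j) * x j)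
        + f c1 i * dot gt + gt i * F"
      unfolding F_def dot_def sum_distrib_left sum.distrib[symmetric]
      by (intro sum.cong) (auto simp: D1[OF i] sum.distrib distrib_left distrib_right)
    also have "\<dots> = (\<Sum>c\<in>C'. f' c i * dot (g c)) + (\<Sum>c\<in>C'. g c i * dot (f' c)) + f c1 i * dot gt + gt i * F"
      unfolding sum_linear_combination dot_def ..
    finally show ?thesis by (simp add: f'0)
  qed
  \<comment> \<open>Pairing the identity \<open>D2\<close> with \<open>x\<close> once more gives
    \<open>2 * F * dot gt = 0\<close>.\<close>
  define e where "e = dot gt"
  have "0 = (\<Sum>i\<in>V. ((\<Sum>c\<in>C'. f' c i * dot (g c)) + f c1 i * e + gt i * F) * x i)"
    using D2 by (simp add: e_def)
  also have "\<dots> = (\<Sum>i\<in>V. (\<Sum>c\<in>C'. dot (g c) * f' c i) * x i) + e * dot (f c1) + F * dot gt"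
    unfolding dot[of "f c1"] dot[of gt] sum_distrib_left[of _ _ V] sum.distrib[symmetric]
    by (intro sum.cong) (auto simp: algebra_simps)
  also have "\<dots> = (\<Sum>c\<in>C'. dot (g c) * dot (f' c)) + e * dot (f c1) + F * dot gt"
    unfolding sum_linear_combination dot[of "f' _"] ..
  finally have "dot gt = 0" using F by (simp add: f'0 e_def flip: F_def)
  then have "gt i * F = - (\<Sum>c\<in>C'. f' c i * dot (g c))" if "i \<in> V" for i
    using D2[OF that] by simp
  note gtF = this
  have gt: "gt i = - (\<Sum>c\<in>C'. f' c i * (dot (g c) / F))" if "i \<in> V" for i
  proof -
    have "gt i * F = - (\<Sum>c\<in>C'. f' c i * dot (g c))" using gtF that .
    then have "gt i = - (\<Sum>c\<in>C'. f' c i * dot (g c)) / F" using F nonzero_mult_div_cancel_right by metis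
    then show ?thesis by (simp add: sum_divide_distrib)
  qed
  have "D i j = sym_prod_sum C' f' g' i j" if "i \<in> V" "j \<in> V" for i j
  proof -
    have "sym_prod_sum C' f' g' i j = (\<Sum>c\<in>C'. (f' c i * g c j + g c i * f' c j)
        - f c1 j * (f' c i * (dot (g c) / F)) - f c1 i * (f' c j * (dot (g c) / F)))"
      unfolding sym_prod_sum_def g'_def by (intro sum.cong) (auto simp: algebra_simps)
    also have "\<dots> = (\<Sum>c\<in>C'. f' c i * g c j + g c i * f' c j) + f c1 j * gt i + f c1 i * gt j"
      unfolding sum_subtractf gt[OF that(1)] gt[OF that(2)] by (simp add: sum_distrib_left)
    finally show ?thesis using D1[OF that] by simp
  qed
  moreover have "pivot_row Q C' B' = f'" using piv by blast
  ultimately have "\<forall>i\<in>V. \<forall>j\<in>V. D i j = sym_prod_sum C' (pivot_row Q C' B') g' i j" by simp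
  then show ?thesis unfolding C'_def by blast
qed

text \<open>Starting from \<open>C = UNIV\<close>, where the pivot rows are those of
  \<open>Q\<close>, a smallest \<open>C\<close> is taken. A pivot row not vanishing on the kernel of
  \<open>D\<close> could be eliminated, so by duality all pivot rows lie in the row space of
  \<open>D\<close>.\<close>

lemma minimal_pivot_decomposition:
  fixes Q N :: "'c::finite \<Rightarrow> 'v \<Rightarrow> real"
  assumes V: "finite V"
    and D: "\<And>i j. i \<in> V \<Longrightarrow> j \<in> V \<Longrightarrow> D i j = sym_prod_sum UNIV Q N i j"
  shows "\<exists>C B g. (\<forall>i\<in>V. \<forall>j\<in>V. D i j = sym_prod_sum C (pivot_row Q C B) g i j) \<and>
    (\<forall>c\<in>C. \<forall>x. (\<forall>i\<in>V. (\<Sum>j\<in>V. D i j * x j) = 0) \<longrightarrow> (\<Sum>j\<in>V. pivot_row Q C B c j * x j) = 0)"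
proof -
  define P where "P = (\<lambda>C. \<exists>B g. \<forall>i\<in>V. \<forall>j\<in>V. D i j = sym_prod_sum C (pivot_row Q C B) g i j)"
  have "pivot_row Q UNIV B = Q" for B by (auto simp: pivot_row_def fun_eq_iff)
  then have "P UNIV" using D by (auto simp: P_def)
  then obtain C where C: "P C" and min: "\<And>C'. P C' \<Longrightarrow> card C \<le> card C'"
    using ex_has_least_nat[of P UNIV card] by blast
  obtain B g where Bg: "\<And>i j. i \<in> V \<Longrightarrow> j \<in> V \<Longrightarrow> D i j = sym_prod_sum C (pivot_row Q C B) g i j"
    using C by (auto simp: P_def)
  have "(\<Sum>j\<in>V. pivot_row Q C B c j * x j) = 0"
    if "c \<in> C" and x: "\<And>i. i \<in> V \<Longrightarrow> (\<Sum>j\<in>V. D i j * x j) = 0" for c x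
  proof (rule ccontr)
    assume "(\<Sum>j\<in>V. pivot_row Q C B c j * x j) \<noteq> 0"
    from pivot_elimination[OF V Bg \<open>c \<in> C\<close> x this] have "P (C - {c})" by (auto simp: P_def)
    from min[OF this] card_Diff1_less[OF finite \<open>c \<in> C\<close>] show False by simp
  qed
  with Bg show ?thesis by (intro exI[of _ C] exI[of _ B] exI[of _ g]) blast
qed

lemma sum_sym_prod_sum:
  "(\<Sum>s\<in>S. y s * sym_prod_sum C f g s i) =
   (\<Sum>c\<in>C. (\<Sum>s\<in>S. y s * f c s) * g c i + (\<Sum>s\<in>S. y s * g c s) * f c i)"
  unfolding sym_prod_sum_def sum_distrib_left sum_distrib_right sum.distrib[symmetric]
  by (subst sum.swap) (simp add: algebra_simps)

text \<open>With more than \<open>2 * card C\<close> rows, some nontrivial combination over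
  \<open>S\<close> annihilates every \<open>f c\<close> and \<open>g c\<close>, and then also the
  rows of \<open>D\<close>.\<close>

lemma card_independent_rows_le:
  fixes f g :: "'c::finite \<Rightarrow> 'v \<Rightarrow> real"
  assumes S: "finite S" "S \<subseteq> V"
    and D: "\<And>i j. i \<in> V \<Longrightarrow> j \<in> V \<Longrightarrow> D i j = sym_prod_sum C f g i j"
    and indep: "\<forall>y. (\<forall>i\<in>V. (\<Sum>s\<in>S. y s * D s i) = 0) \<longrightarrow> (\<forall>s\<in>S. y s = 0)"
  shows "card S \<le> 2 * card C"
proof (rule ccontr)
  assume "\<not> ?thesis"
  then have "card (C \<times> (UNIV :: bool set)) < card S" by (simp add: card_cartesian_product)
  then obtain y where nz: "\<exists>s\<in>S. y s \<noteq> 0"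
    and y: "\<And>c b. c \<in> C \<Longrightarrow> (\<Sum>s\<in>S. (if b then f c s else g c s) * y s) = 0"
    using homogeneous_system_nontrivial[of "C \<times> (UNIV :: bool set)" S "\<lambda>(c, b) s. if b then f c s else g c s"] S(1)
    by auto
  have "(\<Sum>s\<in>S. y s * D s i) = 0" if "i \<in> V" for i
  proof -
    have "(\<Sum>s\<in>S. y s * D s i) = (\<Sum>s\<in>S. y s * sym_prod_sum C f g s i)"
      using S that by (intro sum.cong) (auto simp: D)
    also have "\<dots> = 0"
      unfolding sum_sym_prod_sum using y[of _ True] y[of _ False] by (intro sum.neutral) (simp add: mult.commute)
    finally show ?thesis .
  qed
  with indep nz show False by blast
qed

text \<open>
  If \<open>|S| = 2 |C|\<close>, the functions \<open>f\<close> and \<open>g\<close> are independent and \<open>f\<close> spans an isotropic subspace. In the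
  extremal case of the parameter count, where \<open>C\<close> is everything, the relation \<open>\<Sum>s\<in>S. y s * f c s = 0\<close>
  saves one parameter for each \<open>c\<close>.
\<close>

lemma isotropic_combination:
  fixes f g :: "'c::finite \<Rightarrow> 'v \<Rightarrow> real"
  assumes S: "finite S" "S \<subseteq> V" "card S = 2 * card C" and c: "c \<in> C"
    and D: "\<And>i j. i \<in> V \<Longrightarrow> j \<in> V \<Longrightarrow> D i j = sym_prod_sum C f g i j"
    and indep: "\<forall>y. (\<forall>i\<in>V. (\<Sum>s\<in>S. y s * D s i) = 0) \<longrightarrow> (\<forall>s\<in>S. y s = 0)"
  shows "\<exists>y. (\<forall>i\<in>V. f c i = (\<Sum>s\<in>S. y s * D s i)) \<and> (\<Sum>s\<in>S. y s * f c s) = 0"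
proof -
  \<comment> \<open>\<open>None\<close> stands for an unknown scalar \<open>\<tau>\<close> and
    \<open>Some s\<close> for the coefficient of row \<open>s\<close>. The \<open>2 * card C\<close>
    equations ask that the combination annihilate every \<open>f\<close> and every \<open>g\<close>
    except \<open>g c\<close>, on which it takes the value \<open>\<tau>\<close>; there is one
    unknown more.\<close>
  define U where "U = insert None (Some ` S)"
  define A where "A = (\<lambda>(c', b) u. case u of None \<Rightarrow> (if c' = c \<and> \<not> b then - 1 else 0)
    | Some s \<Rightarrow> if b then f c' s else g c' s)"
  have "card U = Suc (card S)" using S by (simp add: U_def card_image)
  then have "card (C \<times> (UNIV :: bool set)) < card U"
    using S(3) by (simp add: card_cartesian_product)
  then obtain y where nz: "\<exists>u\<in>U. y u \<noteq> 0"
    and y: "\<And>t. t \<in> C \<times> (UNIV :: bool set) \<Longrightarrow> (\<Sum>u\<in>U. A t u * y u) = 0"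
    using homogeneous_system_nontrivial[of "C \<times> (UNIV :: bool set)" U A] S(1) by (auto simp: U_def)
  define \<tau> where "\<tau> = y None"
  define w where "w = (\<lambda>s. y (Some s))"
  have split: "(\<Sum>u\<in>U. A t u * y u) = A t None * \<tau> + (\<Sum>s\<in>S. A t (Some s) * w s)" for t
    using S(1) by (simp add: U_def sum.reindex \<tau>_def w_def)
  have wf: "(\<Sum>s\<in>S. w s * f c' s) = 0" if "c' \<in> C" for c'
    using y[of "(c', True)"] that unfolding split by (simp add: A_def mult.commute)
  have wg: "(\<Sum>s\<in>S. w s * g c' s) = (if c' = c then \<tau> else 0)" if "c' \<in> C" for c'
    using y[of "(c', False)"] that unfolding split by (auto simp: A_def mult.commute)
  have comb: "(\<Sum>s\<in>S. w s * D s i) = \<tau> * f c i" if "i \<in> V" for i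
  proof -
    have "(\<Sum>s\<in>S. w s * D s i) = (\<Sum>s\<in>S. w s * sym_prod_sum C f g s i)"
      using S that by (intro sum.cong) (auto simp: D)
    also have "\<dots> = (\<Sum>c'\<in>C. if c' = c then \<tau> * f c i else 0)"
      unfolding sum_sym_prod_sum by (intro sum.cong) (auto simp: wf wg)
    finally show ?thesis using c by simp
  qed
  have "\<tau> \<noteq> 0"
  proof
    assume "\<tau> = 0"
    then have "w s = 0" if "s \<in> S" for s using indep comb that by simp
    with \<open>\<tau> = 0\<close> nz show False by (auto simp: U_def w_def \<tau>_def)
  qed
  then have "\<forall>i\<in>V. f c i = (\<Sum>s\<in>S. w s / \<tau> * D s i)"
    using comb by (simp add: sum_divide_distrib[symmetric])
  moreover have "(\<Sum>s\<in>S. w s / \<tau> * f c s) = 0"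
    using wf[OF c] by (simp add: sum_divide_distrib[symmetric])
  ultimately show ?thesis by (intro exI[of _ "\<lambda>s. w s / \<tau>"] conjI)
qed

section \<open>Counting parameters\<close>

lemma parameter_count:
  fixes a r n k \<rho> \<tau> :: nat
  assumes "2 * a + 2 * k \<le> n + 2" "r \<le> a" "\<rho> \<le> 2 * r" "r < a \<or> \<rho> < 2 * r"
    "2 * \<tau> + \<rho> \<le> 2 * k * \<rho>" "\<tau> \<ge> 1"
  shows "(a - r) * n + r * (a - r) + r * \<rho> + (\<tau> - 1) < a * n"
proof -
  define A R K N P T where "A = int a" and "R = int r" and "K = int k" and "N = int n" and "P = int \<rho>" and "T = int \<tau>"
  have "int (2 * \<tau> + \<rho>) \<le> int (2 * k * \<rho>)" using assms(5) by (simp only: of_nat_le_iff)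
  then have h5: "2 * T + P \<le> 2 * K * P" by (simp add: T_def P_def K_def)
  have h: "2 * A + 2 * K \<le> N + 2" "R \<le> A" "P \<le> 2 * R" "R < A \<or> P < 2 * R" "T \<ge> 1" "R \<ge> 0" "P \<ge> 0"
    using assms unfolding A_def R_def K_def N_def P_def T_def by linarith+
  have K: "K \<ge> 1"
  proof (rule ccontr)
    assume "\<not> K \<ge> 1"
    then have "K = 0" using K_def by simp
    then show False using h h5 by simp
  qed
  \<comment> \<open>Twice the difference of the two sides is at least 2 plus nonnegative multiples
    of these terms. In the excluded case \<open>r = a\<close>, \<open>\<rho> = 2 * r\<close> the
    second factor here would be -1.\<close>
  have "0 \<le> R * (A - R - 1 + (2 * R - P))" using h by (intro mult_nonneg_nonneg) auto
  moreover have "0 \<le> (2 * K - 1) * (2 * R - P)" using h K by (intro mult_nonneg_nonneg) auto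
  moreover have "R * (2 * A + 2 * K - 2) \<le> R * N" using h by (intro mult_left_mono) auto
  ultimately have "2 * ((A - R) * N + R * (A - R) + R * P + (T - 1)) < 2 * (A * N)"
    using h5 by (simp add: algebra_simps)
  then have "(A - R) * N + R * (A - R) + R * P + (T - 1) < A * N" by simp
  then have "int ((a - r) * n + r * (a - r) + r * \<rho> + (\<tau> - 1)) < int (a * n)"
    using assms by (simp add: A_def R_def N_def P_def T_def of_nat_diff)
  then show ?thesis by linarith
qed

text \<open>This is the remaining case \<open>r = a\<close>, \<open>\<rho> = 2 * a\<close>. One
  coefficient saved in each of the \<open>a\<close> rows, hence \<open>2 * a - 1\<close>, restores
  the strict inequality, with a margin of only 1 in the worst case.\<close>

lemma parameter_count_extreme:
  fixes a n k \<tau> :: nat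
  assumes "2 * a + 2 * k \<le> n + 2" "2 * \<tau> + 2 * a \<le> 2 * k * (2 * a)" "\<tau> \<ge> 1"
  shows "a * (2 * a - 1) + (\<tau> - 1) < a * n"
proof -
  have "a \<ge> 1" using assms by (cases a) auto
  have "int a * (2 * int a + 2 * int k) \<le> int a * (int n + 2)"
    using assms(1) by (intro mult_left_mono) auto
  moreover have "int (2 * \<tau> + 2 * a) \<le> int (2 * k * (2 * a))" using assms(2) by (simp only: of_nat_le_iff)
  ultimately have "int a * (2 * int a - 1) + (int \<tau> - 1) < int a * int n"
    by (simp add: algebra_simps)
  then have "int (a * (2 * a - 1) + (\<tau> - 1)) < int (a * n)"
    using assms \<open>a \<ge> 1\<close> by (simp add: of_nat_diff)
  then show ?thesis by linarith
qed

text \<open>The rows of \<open>Q\<close> outside \<open>C\<close> are parameters. A pivot row is a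
  combination of rows of \<open>E\<close>, and removing its known multiples of non-pivot rows leaves
  a row of \<open>Q\<close>. The summands of the bound count these free rows, the entries of
  \<open>B\<close>, the coefficients on \<open>S'\<close> and the entries of \<open>E\<close>;
  coefficients on \<open>S - S'\<close> need only lie in the generated field.\<close>

lemma pivot_parametrization:
  fixes Q :: "'c::finite \<Rightarrow> 'v \<Rightarrow> real" and E :: "'v \<Rightarrow> 'v \<Rightarrow> real"
  assumes V: "finite V" and SV: "S \<subseteq> V" and S': "S' \<subseteq> S"
    and E1: "\<And>s i. s \<in> S \<Longrightarrow> i \<in> V \<Longrightarrow> E s i \<in> field_gen (WE \<union> W')"
    and WE: "finite WE"
    and f: "\<And>c i. c \<in> C \<Longrightarrow> i \<in> V \<Longrightarrow> pivot_row Q C B c i = (\<Sum>s\<in>S. Y c s * E s i)"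
    and W': "W' = (\<lambda>(c, i). Q c i) ` ((- C) \<times> V) \<union> (\<lambda>(c, c'). B c c') ` (C \<times> (- C)) \<union> (\<lambda>(c, s). Y c s) ` (C \<times> S')"
    and Y: "\<And>c s. c \<in> C \<Longrightarrow> s \<in> S - S' \<Longrightarrow> Y c s \<in> field_gen (WE \<union> W')"
    and gen: "\<And>W. finite W \<Longrightarrow> (\<And>c i. i \<in> V \<Longrightarrow> Q c i \<in> field_gen W) \<Longrightarrow> CARD('c) * card V \<le> card W"
  shows "CARD('c) * card V \<le>
    (CARD('c) - card C) * card V + card C * (CARD('c) - card C) + card C * card S' + card WE"
proof -
  have finS: "finite S" using finite_subset[OF SV V] .
  have finS': "finite S'" using finite_subset[OF S' finS] .
  have finW': "finite W'" unfolding W' using V finS' by (intro finite_UnI finite_imageI finite_cartesian_product) auto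
  have inW: "x \<in> field_gen (WE \<union> W')" if "x \<in> W'" for x using that by (auto intro: field_gen.incl)
  have "Q c i \<in> field_gen (WE \<union> W')" if i: "i \<in> V" for c i
  proof (cases "c \<in> C")
    case False
    then show ?thesis using i by (intro inW) (auto simp: W')
  next
    case c: True
    have Yc: "Y c s \<in> field_gen (WE \<union> W')" if "s \<in> S" for s
    proof (cases "s \<in> S'")
      case True
      then show ?thesis using c by (intro inW) (auto simp: W')
    qed (use Y c that in auto)
    have "pivot_row Q C B c i \<in> field_gen (WE \<union> W')"
      unfolding f[OF c i] by (intro field_gen_sum field_gen.mult Yc E1 i)
    moreover have "(\<Sum>c'\<in>- C. B c c' * Q c' i) \<in> field_gen (WE \<union> W')"
      using c i by (intro field_gen_sum field_gen.mult inW) (auto simp: W')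
    ultimately have "pivot_row Q C B c i - (\<Sum>c'\<in>- C. B c c' * Q c' i) \<in> field_gen (WE \<union> W')"
      by (rule field_gen_diff)
    then show ?thesis by (simp add: pivot_row_def)
  qed
  with gen[of "WE \<union> W'"] finW' WE have "CARD('c) * card V \<le> card (WE \<union> W')" by blast
  also have "\<dots> \<le> card WE + card W'" by (rule card_Un_le)
  also have "card W' \<le> card ((- C) \<times> V) + card (C \<times> (- C)) + card (C \<times> S')"
    unfolding W' using V finS'
    by (intro order.trans[OF card_Un_le] add_mono card_image_le finite_cartesian_product) auto
  also have "\<dots> = (CARD('c) - card C) * card V + card C * (CARD('c) - card C) + card C * card S'"
    by (simp add: card_cartesian_product Compl_eq_Diff_UNIV card_Diff_subset)
  finally show ?thesis by simp
qed


text \<open>Genericity enters only through \<open>gen\<close>, which any parametrization of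
  \<open>Q\<close> by too few numbers contradicts. With \<open>d + 1\<close> elements in
  \<open>'c\<close>, the hypothesis \<open>n\<close> reads
  \<open>2 * d + 2 * k \<le> card V\<close>.\<close>

lemma generic_symmetric_form_zero:
  fixes Q N :: "'c::finite \<Rightarrow> 'v \<Rightarrow> real"
  assumes V: "finite V"
    and D: "\<And>i j. i \<in> V \<Longrightarrow> j \<in> V \<Longrightarrow> D i j = sym_prod_sum UNIV Q N i j"
    and diag: "\<And>i. i \<in> V \<Longrightarrow> D i i = 0"
    and deg: "\<And>i. i \<in> V \<Longrightarrow> card {j\<in>V. D i j \<noteq> 0} \<le> k"
    and n: "2 * CARD('c) + 2 * k \<le> card V + 2"
    and gen: "\<And>W. finite W \<Longrightarrow> (\<And>c i. i \<in> V \<Longrightarrow> Q c i \<in> field_gen W) \<Longrightarrow> CARD('c) * card V \<le> card W"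
    and ij: "i0 \<in> V" "j0 \<in> V"
  shows "D i0 j0 = 0"
proof (rule ccontr)
  assume nz0: "D i0 j0 \<noteq> 0"
  have sym: "D i j = D j i" if "i \<in> V" "j \<in> V" for i j
    unfolding D[OF that] D[OF that(2,1)] sym_prod_sum_def by (intro sum.cong) auto
  obtain C B g where DC: "\<And>i j. i \<in> V \<Longrightarrow> j \<in> V \<Longrightarrow> D i j = sym_prod_sum C (pivot_row Q C B) g i j"
    and fker: "\<And>c x. c \<in> C \<Longrightarrow> (\<And>i. i \<in> V \<Longrightarrow> (\<Sum>j\<in>V. D i j * x j) = 0) \<Longrightarrow>
       (\<Sum>j\<in>V. pivot_row Q C B c j * x j) = 0"
    using minimal_pivot_decomposition[where D = D, OF V D] by auto
  obtain S where SV: "S \<subseteq> V"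
    and ker: "\<And>x j. (\<And>s. s \<in> S \<Longrightarrow> (\<Sum>i\<in>V. D s i * x i) = 0) \<Longrightarrow> j \<in> V \<Longrightarrow> (\<Sum>i\<in>V. D j i * x i) = 0"
    and indep: "\<forall>y. (\<forall>i\<in>V. (\<Sum>s\<in>S. y s * D s i) = 0) \<longrightarrow> (\<forall>s\<in>S. y s = 0)"
    and nbr: "\<And>s. s \<in> S \<Longrightarrow> \<exists>s'\<in>S. D s s' \<noteq> 0"
    using symmetric_row_basis[where D = D, OF V sym] by auto
  have finS: "finite S" using finite_subset[OF SV V] .
  have "S \<noteq> {}"
  proof
    assume "S = {}"
    then have "(\<Sum>i\<in>V. D i0 i * (if i = j0 then 1 else 0)) = 0"
      using ker[where x = "\<lambda>i. if i = j0 then 1 else 0", OF _ ij(1)] by blast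
    then show False using sum_mult_indicator[OF V ij(2), of "D i0"] nz0 by simp
  qed
  then obtain s0 where s0: "s0 \<in> S" by blast
  have rank: "card S \<le> 2 * card C"
    by (rule card_independent_rows_le[OF finS SV DC indep])
  obtain T where TS: "T \<subseteq> S \<times> V" and cardT: "2 * card T + card S \<le> 2 * k * card S"
    and T: "\<And>s i. s \<in> S \<Longrightarrow> i \<in> V \<Longrightarrow> D s i \<noteq> 0 \<Longrightarrow> (s, i) \<in> T \<or> (i, s) \<in> T"
    using edge_representatives[where R = "\<lambda>i j. D i j \<noteq> 0" and k = k, OF V SV _ _ deg nbr] sym diag by auto
  have finT: "finite T" using finite_subset[OF TS] finS V by blast
  obtain i1 where i1: "i1 \<in> S" "D s0 i1 \<noteq> 0" using nbr[OF s0] by blast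
  \<comment> \<open>Dividing \<open>D\<close> by one of its nonzero entries turns that entry into 1
    and saves a parameter; the factor is absorbed into the coefficients of the row
    combinations.\<close>
  define \<delta> where "\<delta> = D s0 i1"
  obtain t1 where t1: "t1 \<in> T" "D (fst t1) (snd t1) = \<delta>"
    using T[OF s0 _ i1(2)] i1(1) s0 SV sym unfolding \<delta>_def by (metis fst_conv snd_conv subsetD)
  have "\<delta> \<noteq> 0" using i1 by (simp add: \<delta>_def)
  have "card T \<ge> 1" using t1(1) finT by (auto simp: Suc_le_eq card_gt_0_iff)
  define E where "E = (\<lambda>s i. D s i / \<delta>)"
  define WE where "WE = (\<lambda>(s, i). E s i) ` (T - {t1})"
  have finWE: "finite WE" using finT by (simp add: WE_def)
  have cardWE: "card WE \<le> card T - 1"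
    unfolding WE_def using card_image_le[of "T - {t1}"] finT t1(1) by (simp add: card_Diff_singleton)
  have ET: "E s i \<in> field_gen (WE \<union> W')" if "(s, i) \<in> T" for s i W'
  proof (cases "(s, i) = t1")
    case True
    then have "E s i = 1" using t1(2) \<open>\<delta> \<noteq> 0\<close> by (auto simp: E_def)
    then show ?thesis by (simp add: field_gen_1)
  next
    case False
    then show ?thesis using that by (intro field_gen.incl) (auto simp: WE_def)
  qed
  have E1: "E s i \<in> field_gen (WE \<union> W')" if "s \<in> S" "i \<in> V" for s i W'
  proof (cases "D s i = 0")
    case True
    then show ?thesis by (simp add: E_def field_gen_0)
  next
    case False
    have "E s i = E i s" using sym that SV by (auto simp: E_def)
    with T[OF that False] ET show ?thesis by metis
  qed
  have scale: "(\<Sum>s\<in>S. y s * D s i) = (\<Sum>s\<in>S. (\<delta> * y s) * E s i)" for y i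
    using \<open>\<delta> \<noteq> 0\<close> by (intro sum.cong) (auto simp: E_def)
  have cC: "card C \<le> CARD('c)" by (intro card_mono) auto
  show False
  \<comment> \<open>In the first case all coefficients on \<open>S\<close> are taken as parameters;
    in the extremal case the one at \<open>s0\<close> is computed from the others.\<close>
  proof (cases "card C < CARD('c) \<or> card S < 2 * card C")
    case True
    have "\<exists>y. \<forall>i\<in>V. pivot_row Q C B c i = (\<Sum>s\<in>S. y s * D s i)" if "c \<in> C" for c
      using in_span_if_vanishes_on_kernel[OF finS V, of D "pivot_row Q C B c"] fker[OF that] ker by blast
    then obtain Y where Y: "\<And>c i. c \<in> C \<Longrightarrow> i \<in> V \<Longrightarrow> pivot_row Q C B c i = (\<Sum>s\<in>S. Y c s * D s i)"
      by metis
    have "CARD('c) * card V \<le>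
      (CARD('c) - card C) * card V + card C * (CARD('c) - card C) + card C * card S + card WE"
    proof (rule pivot_parametrization[OF V SV subset_refl E1 finWE _ refl _ gen])
      show "pivot_row Q C B c i = (\<Sum>s\<in>S. (\<lambda>c s. \<delta> * Y c s) c s * E s i)" if "c \<in> C" "i \<in> V" for c i
        using Y[OF that] scale by simp
    qed auto
    with parameter_count[OF n cC rank True cardT \<open>card T \<ge> 1\<close>] cardWE show False by linarith
  next
    case False
    then have "card C = CARD('c)" and cS: "card S = 2 * card C" using cC rank by auto
    then have C: "C = UNIV" using card_subset_eq[of UNIV C] by simp
    have piv: "pivot_row Q C B = Q" by (simp add: C pivot_row_def fun_eq_iff)
    have "\<exists>y. (\<forall>i\<in>V. Q c i = (\<Sum>s\<in>S. y s * D s i)) \<and> (\<Sum>s\<in>S. y s * Q c s) = 0" for c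
      using isotropic_combination[OF finS SV cS _ DC indep, of c] unfolding piv by (simp add: C)
    then obtain Y where Y: "\<And>c i. i \<in> V \<Longrightarrow> Q c i = (\<Sum>s\<in>S. Y c s * D s i)"
      and Y0: "\<And>c. (\<Sum>s\<in>S. Y c s * Q c s) = 0"
      by metis
    define Z where "Z = (\<lambda>c s. \<delta> * Y c s)"
    have Z: "Q c i = (\<Sum>s\<in>S. Z c s * E s i)" if "i \<in> V" for c i
      using Y[OF that] scale by (simp add: Z_def)
    have Z0: "(\<Sum>s\<in>S. Z c s * Q c s) = 0" for c
      using Y0[of c] by (simp add: Z_def mult.assoc flip: sum_distrib_left)
    \<comment> \<open>The relation \<open>Z0\<close> is linear in \<open>Z c s0\<close>, because \<open>E s0 s0 = 0\<close>, with coefficient \<open>2 * Q c s0\<close>.\<close>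
    define S' where "S' = S - {s0}"
    have S: "S = insert s0 S'" "s0 \<notin> S'" "finite S'" using s0 finS by (auto simp: S'_def)
    \<comment> \<open>A vanishing entry would leave one number too few to generate all of
      \<open>Q\<close>.\<close>
    have Q0: "Q c s0 \<noteq> 0" for c
    proof
      assume q0: "Q c s0 = 0"
      define W where "W = (\<lambda>(c, i). Q c i) ` (UNIV \<times> V - {(c, s0)})"
      have "Q c' i \<in> field_gen W" if "i \<in> V" for c' i
      proof (cases "(c', i) = (c, s0)")
        case True
        then show ?thesis using q0 by (simp add: field_gen_0)
      next
        case False
        then show ?thesis using that by (intro field_gen.incl) (force simp: W_def)
      qed
      moreover have "finite W" using V by (simp add: W_def)
      ultimately have "CARD('c) * card V \<le> card W" by (intro gen)
      also have "\<dots> \<le> card ((UNIV :: 'c set) \<times> V - {(c, s0)})"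
        unfolding W_def using V by (intro card_image_le) auto
      also have "\<dots> < card ((UNIV :: 'c set) \<times> V)"
        using V s0 SV by (intro card_Diff1_less) auto
      finally show False by (simp add: card_cartesian_product)
    qed
    define W' where "W' = (\<lambda>(c, i). Q c i) ` ((- C) \<times> V) \<union> (\<lambda>(c, c'). B c c') ` (C \<times> (- C)) \<union> (\<lambda>(c, s). Z c s) ` (C \<times> S')"
    have Zs0: "Z c s0 \<in> field_gen (WE \<union> W')" for c
    proof -
      let ?F = "field_gen (WE \<union> W')"
      have ZF: "Z c s \<in> ?F" if "s \<in> S'" for s
        using that by (intro field_gen.incl) (auto simp: W'_def C)
      \<comment> \<open>\<open>R\<close> collects the terms avoiding \<open>s0\<close> in the
        quadratic form of \<open>E\<close> at \<open>Z c\<close>; the mixed terms contribute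
        \<open>Z c s0 * Q c s0\<close> twice.\<close>
      define R where "R = (\<Sum>s\<in>S'. Z c s * (\<Sum>s'\<in>S'. Z c s' * E s' s))"
      have E00: "E s0 s0 = 0" using diag s0 SV by (auto simp: E_def)
      have P: "Q c s0 = (\<Sum>s\<in>S'. Z c s * E s s0)"
        using Z[of s0 c] s0 SV S E00 by auto
      have "Q c s = Z c s0 * E s s0 + (\<Sum>s'\<in>S'. Z c s' * E s' s)" if "s \<in> S'" for s
      proof -
        have "s \<in> V" "s0 \<in> V" using that s0 SV S by auto
        then show ?thesis using Z[of s c] S sym[of s s0] by (simp add: E_def)
      qed
      then have "(\<Sum>s\<in>S'. Z c s * Q c s) = (\<Sum>s\<in>S'. Z c s0 * (Z c s * E s s0) + Z c s * (\<Sum>s'\<in>S'. Z c s' * E s' s))"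
        by (intro sum.cong) (auto simp: algebra_simps)
      also have "\<dots> = Z c s0 * Q c s0 + R"
        by (simp add: sum.distrib R_def P sum_distrib_left)
      finally have "Z c s0 * Q c s0 + (Z c s0 * Q c s0 + R) = 0"
        using Z0[of c] S by simp
      then have "Z c s0 * (2 * Q c s0) = - R" by (simp add: algebra_simps)
      then have "Z c s0 = - R / (2 * Q c s0)" using Q0[of c] by (subst nonzero_eq_divide_eq) auto
      moreover have "R \<in> ?F"
        unfolding R_def using S SV by (intro field_gen_sum field_gen.mult ZF E1) auto
      moreover have "Q c s0 \<in> ?F"
        unfolding P using S SV by (intro field_gen_sum field_gen.mult ZF E1) auto
      moreover have "2 \<in> ?F" using field_gen.rat[of 2] by simp
      ultimately show ?thesis by (simp add: field_gen_divide field_gen_minus field_gen.mult)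
    qed
    have "CARD('c) * card V \<le>
      (CARD('c) - card C) * card V + card C * (CARD('c) - card C) + card C * card S' + card WE"
    proof (rule pivot_parametrization[OF V SV _ E1 finWE _ W'_def _ gen])
      show "S' \<subseteq> S" using S by blast
      show "pivot_row Q C B c i = (\<Sum>s\<in>S. Z c s * E s i)" if "c \<in> C" "i \<in> V" for c i
        unfolding piv using Z[OF that(2)] .
      show "Z c s \<in> field_gen (WE \<union> W')" if "c \<in> C" "s \<in> S - S'" for c s
        using Zs0 that S by auto
    qed auto
    moreover have "card S' = 2 * CARD('c) - 1" using S cS C by simp
    moreover have "2 * card T + 2 * CARD('c) \<le> 2 * k * (2 * CARD('c))" using cardT cS C by simp
    note parameter_count_extreme[OF n this \<open>card T \<ge> 1\<close>]
    ultimately show False using cardWE C by simp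
  qed
qed

section \<open>Rigidity of generic frameworks\<close>

lemma alg_indep_Q_subset: "alg_indep_Q I c \<Longrightarrow> J \<subseteq> I \<Longrightarrow> alg_indep_Q J c"
  unfolding alg_indep_Q_def by (meson inj_on_subset order.trans)

lemma alg_indep_Q_nonzero:
  assumes "alg_indep_Q I c" "i \<in> I"
  shows "c i \<noteq> 0"
proof
  assume "c i = 0"
  define m where "m = (\<lambda>j. if j = i then 1 else 0 :: nat)"
  have "(1 :: rat) = 0"
    using assms \<open>c i = 0\<close>
    by (intro alg_indep_Q_relation[of I c "{i}" "{m}" "\<lambda>_. 1" m]) (auto simp: m_def)
  then show False by simp
qed

lemma sum_UNIV_option:
  fixes f :: "'d::finite option \<Rightarrow> real"
  shows "(\<Sum>c\<in>UNIV. f c) = f None + (\<Sum>k\<in>UNIV. f (Some k))"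
  by (simp add: UNIV_option_conv sum.reindex)

lemma generic_infinitesimally_rigid:
  fixes p \<mu> :: "'a \<Rightarrow> real ^ 'd::finite"
  assumes V: "finite V" and p: "generic_framework V p"
    and deg: "\<And>i. i \<in> V \<Longrightarrow> card {j\<in>V. j \<noteq> i \<and> \<not> E i j} \<le> k"
    and n: "2 * CARD('d) + 2 * k \<le> card V"
    and \<mu>: "\<And>i j. i \<in> V \<Longrightarrow> j \<in> V \<Longrightarrow> E i j \<Longrightarrow> (p i - p j) \<bullet> (\<mu> i - \<mu> j) = 0"
    and ij: "i0 \<in> V" "j0 \<in> V"
  shows "(p i0 - p j0) \<bullet> (\<mu> i0 - \<mu> j0) = 0"
proof -
  \<comment> \<open>Rescaling the homogeneous coordinates of vertex \<open>v\<close> by a new transcendental \<open>l v\<close> makes all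
    \<open>(d + 1) n\<close> of them generic.\<close>
  define c0 where "c0 = (\<lambda>(v, u). case u of None \<Rightarrow> 0 | Some k \<Rightarrow> p v $ k)"
  define h where "h = (\<lambda>(v :: 'a, k :: 'd). (v, Some k))"
  have "inj_on h (V \<times> UNIV)" by (auto simp: h_def inj_on_def)
  moreover have "c0 \<circ> h = (\<lambda>(v, k). p v $ k)" by (auto simp: c0_def h_def fun_eq_iff)
  ultimately have "alg_indep_Q (h ` (V \<times> UNIV)) c0"
    using p by (intro alg_indep_Q_reindex) (auto simp: generic_framework_def)
  moreover have "h ` (V \<times> UNIV) \<inter> V \<times> {None} = {}" by (auto simp: h_def)
  ultimately obtain z where z: "\<forall>i\<in>h ` (V \<times> UNIV). z i = c0 i"
    and "alg_indep_Q (h ` (V \<times> UNIV) \<union> V \<times> {None}) z"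
    using alg_indep_Q_extend_finite[of "h ` (V \<times> UNIV)" c0 "V \<times> {None}"] V by auto
  moreover have "h ` (V \<times> UNIV) \<union> V \<times> {None} = V \<times> UNIV"
  proof -
    have "(v, u) \<in> h ` (V \<times> UNIV) \<union> V \<times> {None}" if "v \<in> V" for v u
      using that by (cases u) (force simp: h_def)+
    then show ?thesis by (auto simp: h_def)
  qed
  ultimately have zind: "alg_indep_Q (V \<times> UNIV) z" by simp
  have zp: "z (v, Some k) = p v $ k" if "v \<in> V" for v k
    using z that by (force simp: h_def c0_def)
  define l where "l = (\<lambda>v. z (v, None))"
  have l: "l v \<noteq> 0" if "v \<in> V" for v
    using alg_indep_Q_nonzero[OF zind] that by (auto simp: l_def)
  define Q where "Q = (\<lambda>u i. case u of None \<Rightarrow> l i | Some k \<Rightarrow> l i * p i $ k)"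
  \<comment> \<open>In \<open>sym_prod_sum UNIV Q N\<close> the component \<open>None\<close> yields
    the terms \<open>p i \<bullet> \<mu> i\<close> and \<open>p j \<bullet> \<mu> j\<close> of the
    strain, and the components \<open>Some k\<close> yield the mixed terms.\<close>
  define N where "N = (\<lambda>u i. case u of None \<Rightarrow> l i * (p i \<bullet> \<mu> i) | Some k \<Rightarrow> - l i * \<mu> i $ k)"
  define D where "D = (\<lambda>i j. l i * l j * ((p i - p j) \<bullet> (\<mu> i - \<mu> j)))"
  have DQ: "D i j = sym_prod_sum UNIV Q N i j" for i j
  proof -
    have "sym_prod_sum UNIV Q N i j =
      l i * l j * (p j \<bullet> \<mu> j + p i \<bullet> \<mu> i - (\<Sum>k\<in>UNIV. p i $ k * \<mu> j $ k) - (\<Sum>k\<in>UNIV. \<mu> i $ k * p j $ k))"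
      unfolding sym_prod_sum_def sum_UNIV_option Q_def N_def
      by (simp add: sum_distrib_left sum.distrib sum_negf sum_subtractf algebra_simps)
    also have "\<dots> = D i j"
      by (simp add: D_def inner_vec_def[of "p i" "\<mu> j"] inner_vec_def[of "\<mu> i" "p j"] inner_diff inner_commute[of "p j" "\<mu> i"])
    finally show ?thesis ..
  qed
  have "D i0 j0 = 0"
  proof (rule generic_symmetric_form_zero[OF V DQ _ _ _ _ ij])
    show "D i i = 0" for i by (simp add: D_def)
    show "card {j\<in>V. D i j \<noteq> 0} \<le> k" if "i \<in> V" for i
      using \<mu> that V by (intro order.trans[OF card_mono deg[OF that]]) (auto simp: D_def)
    show "2 * CARD('d option) + 2 * k \<le> card V + 2" using n by simp
    show "CARD('d option) * card V \<le> card W"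
      if W: "finite W" and QW: "\<And>c i. i \<in> V \<Longrightarrow> Q c i \<in> field_gen W" for W
    proof -
      \<comment> \<open>Dividing by the weight \<open>Q None v\<close> recovers the coordinates of
        \<open>p\<close>, so \<open>W\<close> generates the whole independent family
        \<open>z\<close>.\<close>
      have "z (v, u) \<in> field_gen W" if v: "v \<in> V" for v u
      proof (cases u)
        case None
        then show ?thesis using QW[OF v, of None] by (simp add: Q_def l_def)
      next
        case (Some k)
        have "Q (Some k) v / Q None v \<in> field_gen W" by (intro field_gen_divide QW v)
        then show ?thesis using Some l[OF v] by (simp add: Q_def zp[OF v])
      qed
      then have "card (V \<times> (UNIV :: 'd option set)) \<le> card W"
        using V W by (intro alg_indep_card_le[OF zind]) auto
      then show ?thesis by (simp add: card_cartesian_product mult.commute)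
    qed
  qed
  then show ?thesis using l ij by (simp add: D_def)
qed

section \<open>Affine frames and normalized motions\<close>

definition frame :: "('a \<Rightarrow> real ^ 'd) \<Rightarrow> 'a \<Rightarrow> ('d \<Rightarrow> 'a) \<Rightarrow> real ^ 'd ^ 'd" where
  "frame p i0 h = (\<chi> k. p (h k) - p i0)"

lemma frame_nondegenerate:
  assumes "det (frame p i0 h) \<noteq> 0" "\<And>k. (p (h k) - p i0) \<bullet> w = 0"
  shows "w = 0"
proof -
  have "frame p i0 h *v w = 0"
    using assms(2) by (simp add: frame_def vec_eq_iff matrix_vector_mult_def inner_vec_def)
  then show ?thesis
    using assms(1) matrix_left_invertible_ker invertible_det_nz invertible_left_inverse by blast
qed

text \<open>A singular frame would place \<open>d + 1\<close> points on a hyperplane with normal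
  \<open>w\<close>. One coordinate of each of \<open>d\<close> points is then determined by the
  others and by the direction of \<open>w\<close>, which costs only \<open>d - 1\<close> parameters,
  against genericity.\<close>

lemma generic_frame:
  fixes p :: "'a \<Rightarrow> real ^ 'd::finite"
  assumes V: "finite V" and p: "generic_framework V p" and n: "CARD('d) < card V"
  shows "\<exists>i0\<in>V. \<exists>h. range h \<subseteq> V \<and> det (frame p i0 h) \<noteq> 0"
proof -
  have "card (UNIV :: 'd option set) \<le> card V" using n by simp
  then obtain g :: "'d option \<Rightarrow> 'a" where g: "inj g" "range g \<subseteq> V"
    using card_le_inj[OF finite V] by blast
  define i0 where "i0 = g None"
  define h where "h = g \<circ> Some"
  have ne: "h k \<noteq> i0" for k using g(1) by (simp add: h_def i0_def inj_eq)
  have inj: "inj h" using g(1) by (auto simp: h_def inj_def)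
  have "det (frame p i0 h) \<noteq> 0"
  proof
    assume "det (frame p i0 h) = 0"
    then obtain w where w: "w \<noteq> 0" "frame p i0 h *v w = 0"
      using matrix_left_invertible_ker invertible_det_nz invertible_left_inverse by blast
    obtain c0 where c0: "w $ c0 \<noteq> 0" using w(1) by (auto simp: vec_eq_iff)
    \<comment> \<open>Scaling the normal to \<open>b c0 = 1\<close> leaves \<open>d - 1\<close> free
      entries.\<close>
    define b where "b = (\<lambda>c. w $ c / w $ c0)"
    define I where "I = range g \<times> (UNIV :: 'd set)"
    define W where "W = range (\<lambda>c. p i0 $ c) \<union> (\<lambda>(k, c). p (h k) $ c) ` (UNIV \<times> (UNIV - {c0})) \<union> b ` (UNIV - {c0})"
    have ind: "alg_indep_Q I (\<lambda>(v, k). p v $ k)"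
      using p g(2) unfolding generic_framework_def I_def by (elim alg_indep_Q_subset) auto
    have W1: "p i0 $ c \<in> field_gen W" for c by (rule field_gen.incl) (auto simp: W_def)
    have W2: "p (h k) $ c \<in> field_gen W" if "c \<noteq> c0" for k c
      using that by (intro field_gen.incl) (auto simp: W_def)
    have W3: "b c \<in> field_gen W" if "c \<noteq> c0" for c using that by (intro field_gen.incl) (auto simp: W_def)
    have W4: "p (h k) $ c0 \<in> field_gen W" for k
    proof -
      have "0 = (\<Sum>c\<in>UNIV. (p (h k) $ c - p i0 $ c) * w $ c)"
        using arg_cong[OF w(2), of "\<lambda>v. v $ k"] by (simp add: frame_def matrix_vector_mult_def)
      also have "\<dots> = (p (h k) $ c0 - p i0 $ c0) * w $ c0 + (\<Sum>c\<in>UNIV - {c0}. (p (h k) $ c - p i0 $ c) * (b c * w $ c0))"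
        using c0 by (simp add: sum.remove[of UNIV c0] b_def)
      also have "\<dots> = w $ c0 * (p (h k) $ c0 - p i0 $ c0 + (\<Sum>c\<in>UNIV - {c0}. (p (h k) $ c - p i0 $ c) * b c))"
        by (simp add: sum_distrib_left algebra_simps)
      finally have "p (h k) $ c0 = p i0 $ c0 - (\<Sum>c\<in>UNIV - {c0}. (p (h k) $ c - p i0 $ c) * b c)"
        using c0 by simp
      also have "\<dots> \<in> field_gen W"
        by (intro field_gen_diff field_gen_sum field_gen.mult W1 W2 W3) auto
      finally show ?thesis .
    qed
    have "(\<lambda>(v, k). p v $ k) ` I \<subseteq> field_gen W"
    proof -
      have "p (g u) $ c \<in> field_gen W" for u c
        using W1[of c] W2[of c] W4 by (cases u; cases "c = c0") (auto simp: h_def i0_def)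
      then show ?thesis by (auto simp: I_def)
    qed
    then have "card I \<le> card W" by (intro alg_indep_card_le[OF ind]) (auto simp: I_def W_def)
    also have "card W \<le> CARD('d) + card ((UNIV :: 'd set) \<times> (UNIV - {c0})) + card (UNIV - {c0})"
      unfolding W_def by (intro order.trans[OF card_Un_le] add_mono card_image_le) auto
    also have "\<dots> = CARD('d) + CARD('d) * (CARD('d) - 1) + (CARD('d) - 1)"
      by (simp add: card_cartesian_product card_Diff_singleton)
    also have "\<dots> < CARD('d) + CARD('d) * CARD('d)"
      by (cases "CARD('d)") auto
    also have "\<dots> = card I"
      using g(1) by (simp add: I_def card_cartesian_product card_image)
    finally show False by simp
  qed
  moreover have "i0 \<in> V" "range h \<subseteq> V" using g(2) by (auto simp: i0_def h_def)
  ultimately show ?thesis by blast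
qed

text \<open>The columns of a right inverse of the frame matrix are the dual basis. Vectors expand in
  it by nondegeneracy, and pairing that expansion with a second vector gives the expansion in the
  frame itself.\<close>

lemma dual_frame:
  fixes p :: "'a \<Rightarrow> real ^ 'd::finite"
  assumes "det (frame p i0 h) \<noteq> 0"
  shows "\<exists>\<epsilon>. (\<forall>k l. (p (h k) - p i0) \<bullet> \<epsilon> l = (if k = l then 1 else 0)) \<and>
    (\<forall>v. (\<Sum>k\<in>UNIV. (v \<bullet> \<epsilon> k) *\<^sub>R (p (h k) - p i0)) = v)"
proof -
  define e where "e = (\<lambda>k. p (h k) - p i0)"
  obtain B where B: "frame p i0 h ** B = mat 1"
    using assms invertible_det_nz invertible_right_inverse by blast
  define \<epsilon> where "\<epsilon> = (\<lambda>l. column l B)"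
  have dual: "e k \<bullet> \<epsilon> l = (if k = l then 1 else 0)" for k l
  proof -
    have "e k \<bullet> \<epsilon> l = (frame p i0 h ** B) $ k $ l"
      by (simp add: e_def \<epsilon>_def frame_def matrix_matrix_mult_def inner_vec_def column_def)
    then show ?thesis by (simp add: B mat_def)
  qed
  have exp1: "(\<Sum>k\<in>UNIV. (v \<bullet> e k) *\<^sub>R \<epsilon> k) = v" for v
  proof -
    have "e l \<bullet> (v - (\<Sum>k\<in>UNIV. (v \<bullet> e k) *\<^sub>R \<epsilon> k)) = 0" for l
    proof -
      have "e l \<bullet> (\<Sum>k\<in>UNIV. (v \<bullet> e k) *\<^sub>R \<epsilon> k) = (\<Sum>k\<in>UNIV. if k = l then v \<bullet> e k else 0)"
        unfolding inner_sum_right by (intro sum.cong) (auto simp: dual)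
      then show ?thesis by (simp add: inner_diff_right inner_commute)
    qed
    then have "v - (\<Sum>k\<in>UNIV. (v \<bullet> e k) *\<^sub>R \<epsilon> k) = 0"
      using frame_nondegenerate[OF assms] unfolding e_def by blast
    then show ?thesis by simp
  qed
  have "(\<Sum>k\<in>UNIV. (v \<bullet> \<epsilon> k) *\<^sub>R e k) = v" for v
  proof -
    have "(\<Sum>k\<in>UNIV. (v \<bullet> \<epsilon> k) *\<^sub>R e k) \<bullet> u = v \<bullet> u" for u
    proof -
      have "v \<bullet> u = v \<bullet> (\<Sum>k\<in>UNIV. (u \<bullet> e k) *\<^sub>R \<epsilon> k)" by (simp only: exp1)
      also have "\<dots> = (\<Sum>k\<in>UNIV. (v \<bullet> \<epsilon> k) *\<^sub>R e k) \<bullet> u"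
        by (simp add: inner_sum_left inner_sum_right inner_commute mult.commute)
      finally show ?thesis by simp
    qed
    then show ?thesis using vector_eq_rdot by blast
  qed
  with dual show ?thesis unfolding e_def by blast
qed

text \<open>
  Normalization of a motion modulo infinitesimal isometries: translations are fixed by \<open>\<mu> i0 = 0\<close>, and
  infinitesimal rotations by symmetry of the pairing with the frame. Being closed under limits, it
  replaces the orthogonal complement of the trivial motions in the compactness argument.
\<close>

definition gauged :: "('a \<Rightarrow> real ^ 'd) \<Rightarrow> 'a \<Rightarrow> ('d \<Rightarrow> 'a) \<Rightarrow> ('a \<Rightarrow> real ^ 'd) \<Rightarrow> bool" where
  "gauged q i0 h \<mu> \<longleftrightarrow> \<mu> i0 = 0 \<and> (\<forall>k l. \<mu> (h k) \<bullet> (q (h l) - q i0) = \<mu> (h l) \<bullet> (q (h k) - q i0))"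

text \<open>Subtracting the translation \<open>\<mu> i0\<close> and a skew linear map
  \<open>A\<close> leaves all strains unchanged. \<open>A\<close> is built in the dual basis so that
  its pairing with the frame is the antisymmetric part \<open>M\<close> of the pairing of the
  motion.\<close>

lemma exists_gauged:
  fixes q \<mu> :: "'a \<Rightarrow> real ^ 'd::finite"
  assumes "det (frame q i0 h) \<noteq> 0"
  shows "\<exists>\<mu>'. gauged q i0 h \<mu>' \<and> (\<forall>i j. (q i - q j) \<bullet> (\<mu>' i - \<mu>' j) = (q i - q j) \<bullet> (\<mu> i - \<mu> j))"
proof -
  define e where "e = (\<lambda>k. q (h k) - q i0)"
  obtain \<epsilon> where dual: "\<And>k l. e k \<bullet> \<epsilon> l = (if k = l then 1 else 0)"
    using dual_frame[OF assms] unfolding e_def by blast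
  define U where "U = (\<lambda>k. \<mu> (h k) - \<mu> i0)"
  define M where "M = (\<lambda>k l. (U k \<bullet> e l - U l \<bullet> e k) / 2)"
  define A where "A = (\<lambda>v. \<Sum>k\<in>UNIV. \<Sum>l\<in>UNIV. (M k l * (v \<bullet> \<epsilon> k)) *\<^sub>R \<epsilon> l)"
  have A_diff: "A (v - w) = A v - A w" for v w
    by (simp add: A_def inner_diff_left right_diff_distrib scaleR_diff_left sum_subtractf)
  have skew: "A v \<bullet> v = 0" for v
  proof -
    have "A v \<bullet> v = (\<Sum>k\<in>UNIV. \<Sum>l\<in>UNIV. M k l * ((v \<bullet> \<epsilon> k) * (v \<bullet> \<epsilon> l)))"
      by (simp add: A_def inner_sum_left inner_commute[of "\<epsilon> _" v] mult.assoc)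
    moreover have "(\<Sum>k\<in>UNIV. \<Sum>l\<in>UNIV. M k l * ((v \<bullet> \<epsilon> k) * (v \<bullet> \<epsilon> l))) =
        - (\<Sum>k\<in>UNIV. \<Sum>l\<in>UNIV. M k l * ((v \<bullet> \<epsilon> k) * (v \<bullet> \<epsilon> l)))"
      unfolding sum_negf[symmetric]
      by (subst sum.swap, intro sum.cong refl) (simp add: M_def field_simps)
    ultimately show ?thesis by simp
  qed
  have Ae: "A (e k) \<bullet> e l = M k l" for k l
  proof -
    have "A (e k) \<bullet> e l = (\<Sum>k'\<in>UNIV. \<Sum>l'\<in>UNIV. M k' l' * (e k \<bullet> \<epsilon> k') * (e l \<bullet> \<epsilon> l'))"
      by (simp add: A_def inner_sum_left inner_commute[of "\<epsilon> _" "e l"])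
    also have "\<dots> = (\<Sum>k'\<in>UNIV. if k' = k then M k' l else 0)"
    proof (intro sum.cong refl)
      fix k'
      have "(\<Sum>l'\<in>UNIV. M k' l' * (e k \<bullet> \<epsilon> k') * (e l \<bullet> \<epsilon> l')) =
          (\<Sum>l'\<in>UNIV. if l' = l then M k' l * (e k \<bullet> \<epsilon> k') else 0)"
        by (intro sum.cong) (auto simp: dual)
      then show "(\<Sum>l'\<in>UNIV. M k' l' * (e k \<bullet> \<epsilon> k') * (e l \<bullet> \<epsilon> l')) = (if k' = k then M k' l else 0)"
        by (auto simp: dual)
    qed
    finally show ?thesis by simp
  qed
  define \<mu>' where "\<mu>' = (\<lambda>i. \<mu> i - \<mu> i0 - A (q i - q i0))"
  have "\<mu>' i0 = 0" using A_diff[of 0 0] by (simp add: \<mu>'_def)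
  moreover have "\<mu>' (h k) \<bullet> e l = \<mu>' (h l) \<bullet> e k" for k l
  proof -
    have eq: "\<mu>' (h k) \<bullet> e l = (U k \<bullet> e l + U l \<bullet> e k) / 2" for k l
    proof -
      have "\<mu>' (h k) = U k - A (e k)" by (simp add: \<mu>'_def U_def e_def)
      then have "\<mu>' (h k) \<bullet> e l = U k \<bullet> e l - M k l" by (simp add: inner_diff_left Ae)
      then show ?thesis by (simp add: M_def field_simps)
    qed
    show ?thesis using eq[of k l] eq[of l k] by simp
  qed
  moreover have "(q i - q j) \<bullet> (\<mu>' i - \<mu>' j) = (q i - q j) \<bullet> (\<mu> i - \<mu> j)" for i j
  proof -
    have "\<mu>' i - \<mu>' j = (\<mu> i - \<mu> j) - A (q i - q j)"
      by (simp add: \<mu>'_def A_diff)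
    then show ?thesis using skew[of "q i - q j"] by (simp add: inner_diff_right inner_commute)
  qed
  ultimately show ?thesis unfolding gauged_def e_def by blast
qed

text \<open>Zero strain makes the pairing of the motion with the frame antisymmetric while the gauge
  makes it symmetric, so the motion vanishes on the frame vertices. Any other vertex then moves
  orthogonally to the whole frame.\<close>

lemma gauged_strain_free:
  fixes q \<mu> :: "'a \<Rightarrow> real ^ 'd::finite"
  assumes det: "det (frame q i0 h) \<noteq> 0" and V: "i0 \<in> V" "range h \<subseteq> V" and g: "gauged q i0 h \<mu>"
    and s: "\<And>i j. i \<in> V \<Longrightarrow> j \<in> V \<Longrightarrow> (q i - q j) \<bullet> (\<mu> i - \<mu> j) = 0" and i: "i \<in> V"
  shows "\<mu> i = 0"
proof -
  have \<mu>0: "\<mu> i0 = 0" using g by (simp add: gauged_def)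
  have hV: "h k \<in> V" for k using V by auto
  have base: "(q j - q i0) \<bullet> \<mu> j = 0" if "j \<in> V" for j using s[OF that V(1)] \<mu>0 by simp
  have cross: "(q j - q i0) \<bullet> \<mu> j' + (q j' - q i0) \<bullet> \<mu> j = 0" if "j \<in> V" "j' \<in> V" for j j'
    using s[OF that] base[OF that(1)] base[OF that(2)] by (simp add: inner_diff_left inner_diff_right)
  have h0: "\<mu> (h k) = 0" for k
  proof (rule frame_nondegenerate[OF det])
    fix l
    have "\<mu> (h k) \<bullet> (q (h l) - q i0) = \<mu> (h l) \<bullet> (q (h k) - q i0)"
      using g unfolding gauged_def by blast
    with cross[OF hV[of l] hV[of k]] show "(q (h l) - q i0) \<bullet> \<mu> (h k) = 0"
      by (simp add: inner_commute)
  qed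
  show ?thesis
  proof (rule frame_nondegenerate[OF det])
    fix l
    show "(q (h l) - q i0) \<bullet> \<mu> i = 0" using cross[OF hV[of l] i] h0 by simp
  qed
qed

section \<open>From infinitesimal to continuous rigidity\<close>

lemma bounded_subsequence_finite:
  fixes \<nu> :: "nat \<Rightarrow> 'a \<Rightarrow> 'b::heine_borel"
  assumes "finite V" "compact K" "\<And>n i. i \<in> V \<Longrightarrow> \<nu> n i \<in> K"
  shows "\<exists>r l. strict_mono (r :: nat \<Rightarrow> nat) \<and> (\<forall>i\<in>V. (\<lambda>n. \<nu> (r n) i) \<longlonglongrightarrow> l i)"
  using assms(1,3)
proof (induction V rule: finite_induct)
  case empty
  show ?case by (intro exI[of _ id]) (auto simp: strict_mono_def)
next
  case (insert j V)
  have "\<exists>r l. strict_mono (r :: nat \<Rightarrow> nat) \<and> (\<forall>i\<in>V. (\<lambda>n. \<nu> (r n) i) \<longlonglongrightarrow> l i)"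
    by (rule insert.IH) (use insert.prems in auto)
  then obtain r l where r: "strict_mono (r :: nat \<Rightarrow> nat)" "\<And>i. i \<in> V \<Longrightarrow> (\<lambda>n. \<nu> (r n) i) \<longlonglongrightarrow> l i"
    by blast
  have "seq_compact K" using assms(2) compact_imp_seq_compact by blast
  moreover have "\<forall>n. \<nu> (r n) j \<in> K" using insert.prems by simp
  ultimately obtain x r' where r': "strict_mono r'" "((\<lambda>n. \<nu> (r n) j) \<circ> r') \<longlonglongrightarrow> x"
    by (rule seq_compactE)
  have "(\<lambda>n. \<nu> ((r \<circ> r') n) i) \<longlonglongrightarrow> (l(j := x)) i" if "i \<in> insert j V" for i
  proof (cases "i = j")
    case True
    then show ?thesis using r'(2) by (simp add: o_def)
  next
    case False
    then show ?thesis using LIMSEQ_subseq_LIMSEQ[OF r(2) r'(1), of i] that by (simp add: o_def)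
  qed
  moreover have "strict_mono (r \<circ> r')" using r(1) r'(1) by (rule strict_mono_o)
  ultimately show ?case by blast
qed

lemma tendsto_det:
  fixes A :: "'b \<Rightarrow> real ^ 'd ^ 'd::finite"
  assumes "\<And>i j. ((\<lambda>n. A n $ i $ j) \<longlongrightarrow> L $ i $ j) F"
  shows "((\<lambda>n. det (A n)) \<longlongrightarrow> det L) F"
  unfolding det_def by (intro tendsto_intros assms)

text \<open>Were no \<open>y n\<close> congruent to \<open>p\<close>, gauging and normalizing the
  motions \<open>p - y n\<close> of the midpoint frameworks \<open>z n\<close> would give, in the
  limit, a gauged infinitesimal motion of \<open>p\<close> of total norm 1, which \<open>IR\<close>
  and \<open>gauged_strain_free\<close> exclude.\<close>

lemma local_rigidity:
  fixes p :: "'a \<Rightarrow> real ^ 'd::finite"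
  assumes V: "finite V" "i0 \<in> V" "range h \<subseteq> V" and det: "det (frame p i0 h) \<noteq> 0"
    and IR: "\<And>\<mu> i j. (\<And>i j. i \<in> V \<Longrightarrow> j \<in> V \<Longrightarrow> E i j \<Longrightarrow> (p i - p j) \<bullet> (\<mu> i - \<mu> j) = 0) \<Longrightarrow>
        i \<in> V \<Longrightarrow> j \<in> V \<Longrightarrow> (p i - p j) \<bullet> (\<mu> i - \<mu> j) = 0"
    and lim: "\<And>i. i \<in> V \<Longrightarrow> (\<lambda>n. y n i) \<longlonglongrightarrow> p i"
    and edge: "\<And>n i j. i \<in> V \<Longrightarrow> j \<in> V \<Longrightarrow> E i j \<Longrightarrow> dist (y n i) (y n j) = dist (p i) (p j)"
  shows "\<exists>n::nat. \<forall>i\<in>V. \<forall>j\<in>V. dist (y n i) (y n j) = dist (p i) (p j)"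
proof (rule ccontr)
  assume neg: "\<not> ?thesis"
  define z where "z = (\<lambda>n i. (1 / 2) *\<^sub>R (p i + y n i))"
  have zlim: "(\<lambda>n. z n i) \<longlonglongrightarrow> p i" if "i \<in> V" for i
  proof -
    have "(\<lambda>n. z n i) \<longlonglongrightarrow> (1 / 2) *\<^sub>R (p i + p i)" unfolding z_def by (intro tendsto_intros lim that)
    then show ?thesis by (simp flip: scaleR_2)
  qed
  have "(\<lambda>n. det (frame (z n) i0 h)) \<longlonglongrightarrow> det (frame p i0 h)"
    using V unfolding frame_def by (intro tendsto_det) (auto intro!: tendsto_intros zlim)
  then have "\<forall>\<^sub>F n in sequentially. det (frame (z n) i0 h) \<noteq> 0"
    using det by (rule tendsto_imp_eventually_ne)
  \<comment> \<open>Gauging needs a nondegenerate midpoint frame, hence the index shift by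
    \<open>n0\<close> below.\<close>
  then obtain n0 where n0: "\<And>n. n \<ge> n0 \<Longrightarrow> det (frame (z n) i0 h) \<noteq> 0"
    unfolding eventually_sequentially by blast
  \<comment> \<open>At the midpoint the pairing of sum and difference is a difference of squares, so
    finite changes of length become strains.\<close>
  have strain: "(z n i - z n j) \<bullet> ((p i - y n i) - (p j - y n j)) = ((dist (p i) (p j))\<^sup>2 - (dist (y n i) (y n j))\<^sup>2) / 2" for n i j
    unfolding z_def dist_norm power2_norm_eq_inner
    by (simp add: inner_diff_left inner_diff_right inner_add_left inner_add_right inner_commute field_simps)
  have "\<exists>\<mu>. gauged (z (n + n0)) i0 h \<mu> \<and> (\<forall>i j. (z (n + n0) i - z (n + n0) j) \<bullet> (\<mu> i - \<mu> j) =
      ((dist (p i) (p j))\<^sup>2 - (dist (y (n + n0) i) (y (n + n0) j))\<^sup>2) / 2)" for n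
    using exists_gauged[OF n0[of "n + n0"], of "\<lambda>i. p i - y (n + n0) i"] unfolding strain by simp
  then obtain \<mu> where g: "\<And>n. gauged (z (n + n0)) i0 h (\<mu> n)"
    and s: "\<And>n i j. (z (n + n0) i - z (n + n0) j) \<bullet> (\<mu> n i - \<mu> n j) =
      ((dist (p i) (p j))\<^sup>2 - (dist (y (n + n0) i) (y (n + n0) j))\<^sup>2) / 2" by metis
  \<comment> \<open>This total norm is positive because \<open>y (n + n0)\<close> is not congruent
    to \<open>p\<close>, so some strain is nonzero.\<close>
  define S where "S = (\<lambda>n. \<Sum>i\<in>V. norm (\<mu> n i))"
  have S: "S n > 0" for n
  proof -
    obtain i j where ij: "i \<in> V" "j \<in> V" "dist (y (n + n0) i) (y (n + n0) j) \<noteq> dist (p i) (p j)"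
      using neg by blast
    then have "\<mu> n i - \<mu> n j \<noteq> 0" using s[of n i j] by (auto simp: power2_eq_iff_nonneg)
    then have "\<mu> n i \<noteq> 0 \<or> \<mu> n j \<noteq> 0" by auto
    then show ?thesis unfolding S_def using ij V(1) by (intro sum_pos2[of V "if \<mu> n i \<noteq> 0 then i else j"]) auto
  qed
  define \<nu> where "\<nu> = (\<lambda>n i. (1 / S n) *\<^sub>R \<mu> n i)"
  have "norm (\<mu> n i) \<le> S n" if "i \<in> V" for n i
    unfolding S_def using V(1) that by (intro member_le_sum) auto
  then have "\<nu> n i \<in> cball 0 1" if "i \<in> V" for n i
    using S[of n] that by (simp add: \<nu>_def)
  then obtain r l where r: "strict_mono (r :: nat \<Rightarrow> nat)" and l: "\<And>i. i \<in> V \<Longrightarrow> (\<lambda>n. \<nu> (r n) i) \<longlonglongrightarrow> l i"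
    using bounded_subsequence_finite[OF V(1) compact_cball, of \<nu> 0 1] by blast
  have zl: "(\<lambda>n. z (r n + n0) i) \<longlonglongrightarrow> p i" if "i \<in> V" for i
    using LIMSEQ_subseq_LIMSEQ[OF LIMSEQ_ignore_initial_segment[OF zlim[OF that]] r, of n0] by (simp add: o_def)
  have edge0: "(p i - p j) \<bullet> (l i - l j) = 0" if ij: "i \<in> V" "j \<in> V" "E i j" for i j
  proof -
    have "(z (r n + n0) i - z (r n + n0) j) \<bullet> (\<nu> (r n) i - \<nu> (r n) j) = 0" for n
      using s[of "r n" i j] edge[OF ij] by (simp add: \<nu>_def flip: scaleR_diff_right)
    moreover have "(\<lambda>n. (z (r n + n0) i - z (r n + n0) j) \<bullet> (\<nu> (r n) i - \<nu> (r n) j)) \<longlonglongrightarrow> (p i - p j) \<bullet> (l i - l j)"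
      using ij by (intro tendsto_intros zl l)
    ultimately show ?thesis by (simp add: LIMSEQ_const_iff)
  qed
  have hV: "h k \<in> V" for k using V by auto
  have "gauged p i0 h l"
    unfolding gauged_def
  proof (intro conjI allI)
    have "\<nu> (r n) i0 = 0" for n using g by (simp add: \<nu>_def gauged_def)
    with l[OF V(2)] show "l i0 = 0" by (simp add: LIMSEQ_const_iff)
    fix k m
    have eq: "\<nu> (r n) (h k) \<bullet> (z (r n + n0) (h m) - z (r n + n0) i0) = \<nu> (r n) (h m) \<bullet> (z (r n + n0) (h k) - z (r n + n0) i0)" for n
      using g unfolding \<nu>_def gauged_def by simp
    have 1: "(\<lambda>n. \<nu> (r n) (h k) \<bullet> (z (r n + n0) (h m) - z (r n + n0) i0)) \<longlonglongrightarrow> l (h k) \<bullet> (p (h m) - p i0)"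
      using hV V by (intro tendsto_intros zl l)
    have 2: "(\<lambda>n. \<nu> (r n) (h m) \<bullet> (z (r n + n0) (h k) - z (r n + n0) i0)) \<longlonglongrightarrow> l (h m) \<bullet> (p (h k) - p i0)"
      using hV V by (intro tendsto_intros zl l)
    show "l (h k) \<bullet> (p (h m) - p i0) = l (h m) \<bullet> (p (h k) - p i0)"
      using LIMSEQ_unique[OF 1[unfolded eq] 2] .
  qed
  then have l0: "l i = 0" if "i \<in> V" for i
    using gauged_strain_free[OF det V(2,3) _ IR[OF edge0] that] by blast
  have "(\<Sum>i\<in>V. norm (\<nu> (r n) i)) = 1" for n
  proof -
    have "(\<Sum>i\<in>V. norm (\<nu> (r n) i)) = (\<Sum>i\<in>V. norm (\<mu> (r n) i)) / S (r n)"
      using S[of "r n"] by (simp add: \<nu>_def sum_divide_distrib)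
    also have "(\<Sum>i\<in>V. norm (\<mu> (r n) i)) = S (r n)" by (simp add: S_def)
    finally show ?thesis using S[of "r n"] by simp
  qed
  moreover have "(\<lambda>n. \<Sum>i\<in>V. norm (\<nu> (r n) i)) \<longlonglongrightarrow> (\<Sum>i\<in>V. norm (l i))"
    by (intro tendsto_intros l)
  ultimately show False using l0 by (simp add: LIMSEQ_const_iff)
qed

text \<open>By polarization, equal distances give equal inner products of the difference vectors.
  The linear map \<open>T\<close> matching the two frames therefore preserves inner products, and
  every other vertex is determined by its inner products with the frame.\<close>

lemma congruent_frames:
  fixes p q :: "'a \<Rightarrow> real ^ 'd::finite"
  assumes V: "i0 \<in> V" "range h \<subseteq> V" and det: "det (frame p i0 h) \<noteq> 0"
    and cong: "\<And>i j. i \<in> V \<Longrightarrow> j \<in> V \<Longrightarrow> dist (q i) (q j) = dist (p i) (p j)"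
  shows "\<exists>T. orthogonal_transformation T \<and> (\<forall>i\<in>V. T (p i - p i0) = q i - q i0)"
proof -
  define e where "e = (\<lambda>k. p (h k) - p i0)"
  define f where "f = (\<lambda>k. q (h k) - q i0)"
  have hV: "h k \<in> V" for k using V by auto
  obtain \<epsilon> where dual: "\<And>k l. e k \<bullet> \<epsilon> l = (if k = l then 1 else 0)"
    and exp: "\<And>v. (\<Sum>k\<in>UNIV. (v \<bullet> \<epsilon> k) *\<^sub>R e k) = v"
    using dual_frame[OF det] unfolding e_def by blast
  have gram: "(q i - q i0) \<bullet> (q j - q i0) = (p i - p i0) \<bullet> (p j - p i0)" if "i \<in> V" "j \<in> V" for i j
  proof -
    have polar: "u \<bullet> v = ((norm u)\<^sup>2 + (norm v)\<^sup>2 - (norm (u - v))\<^sup>2) / 2" for u v :: "real ^ 'd"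
      by (simp add: power2_norm_eq_inner inner_diff_left inner_diff_right inner_commute field_simps)
    show ?thesis unfolding polar
      using cong[OF that(1) V(1)] cong[OF that(2) V(1)] cong[OF that] by (simp add: dist_norm)
  qed
  define T where "T = (\<lambda>v. \<Sum>k\<in>UNIV. (v \<bullet> \<epsilon> k) *\<^sub>R f k)"
  have Te: "T (e k) = f k" for k
  proof -
    have "T (e k) = (\<Sum>l\<in>UNIV. if l = k then f l else 0)"
      unfolding T_def by (intro sum.cong) (auto simp: dual)
    then show ?thesis by simp
  qed
  have "linear T"
    by (rule linearI) (simp_all add: T_def inner_add_left scaleR_add_left sum.distrib scaleR_sum_right)
  moreover have inner: "T v \<bullet> T w = v \<bullet> w" for v w
  proof -
    have "T v \<bullet> T w = (\<Sum>k\<in>UNIV. \<Sum>l\<in>UNIV. (v \<bullet> \<epsilon> k) * ((w \<bullet> \<epsilon> l) * (f k \<bullet> f l)))"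
      unfolding T_def by (subst inner_sum_left) (simp add: inner_sum_right sum_distrib_left mult.left_commute)
    also have "\<dots> = (\<Sum>k\<in>UNIV. \<Sum>l\<in>UNIV. (v \<bullet> \<epsilon> k) * ((w \<bullet> \<epsilon> l) * (e k \<bullet> e l)))"
      by (simp add: e_def f_def gram hV)
    also have "\<dots> = (\<Sum>k\<in>UNIV. (v \<bullet> \<epsilon> k) *\<^sub>R e k) \<bullet> (\<Sum>l\<in>UNIV. (w \<bullet> \<epsilon> l) *\<^sub>R e l)"
      by (subst inner_sum_left) (simp add: inner_sum_right sum_distrib_left mult.left_commute)
    finally show ?thesis by (simp add: exp)
  qed
  ultimately have T: "orthogonal_transformation T" by (simp add: orthogonal_transformation_def)
  have "T (p i - p i0) = q i - q i0" if i: "i \<in> V" for i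
  proof -
    \<comment> \<open>\<open>w\<close> is the preimage of the discrepancy; it will be orthogonal to
      the frame of \<open>p\<close> and hence zero.\<close>
    obtain w where w: "T w = T (p i - p i0) - (q i - q i0)"
      using orthogonal_transformation_surj[OF T] by (metis surjD)
    have "e k \<bullet> w = 0" for k
    proof -
      have "e k \<bullet> w = T (e k) \<bullet> (T (p i - p i0) - (q i - q i0))" by (simp add: inner flip: w)
      also have "\<dots> = e k \<bullet> (p i - p i0) - f k \<bullet> (q i - q i0)"
        by (simp add: inner_diff_right inner Te[of k] inner[of "e k", unfolded Te])
      also have "\<dots> = 0" using gram[OF hV i, of k] by (simp add: e_def f_def)
      finally show ?thesis .
    qed
    then have "w = 0" using frame_nondegenerate[OF det] unfolding e_def by blast
    with w show ?thesis using linear_0[OF \<open>linear T\<close>] by simp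
  qed
  with T show ?thesis by blast
qed


text \<open>The times at which the motion is congruent to \<open>p\<close> form a closed and open
  subset of the interval containing 0. Openness comes from \<open>local_rigidity\<close>, applied
  after moving the framework at time \<open>t0\<close> back onto \<open>p\<close>.\<close>

lemma rigid_if_infinitesimally_rigid:
  fixes p :: "'a \<Rightarrow> real ^ 'd::finite"
  assumes V: "finite V" "i0 \<in> V" "range h \<subseteq> V" and det: "det (frame p i0 h) \<noteq> 0"
    and IR: "\<And>\<mu> i j. (\<And>i j. i \<in> V \<Longrightarrow> j \<in> V \<Longrightarrow> E i j \<Longrightarrow> (p i - p j) \<bullet> (\<mu> i - \<mu> j) = 0) \<Longrightarrow>
        i \<in> V \<Longrightarrow> j \<in> V \<Longrightarrow> (p i - p j) \<bullet> (\<mu> i - \<mu> j) = 0"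
  shows "rigid_framework V E p"
  unfolding rigid_framework_def
proof (intro allI impI, elim conjE)
  fix x :: "real \<Rightarrow> 'a \<Rightarrow> real ^ 'd"
  assume cont: "\<forall>v\<in>V. continuous_on {0..1} (\<lambda>t. x t v)" and x0: "\<forall>v\<in>V. x 0 v = p v"
    and edge: "\<forall>t\<in>{0..1}. \<forall>u\<in>V. \<forall>v\<in>V. E u v \<longrightarrow> dist (x t u) (x t v) = dist (p u) (p v)"
  define A where "A = {t \<in> {0..1}. \<forall>i\<in>V. \<forall>j\<in>V. dist (x t i) (x t j) = dist (p i) (p j)}"
  have "closedin (top_of_set {0..1}) A"
  proof -
    have "closedin (top_of_set {0..1}) {t \<in> {0..1}. dist (x t i) (x t j) = dist (p i) (p j)}"
      if "i \<in> V" "j \<in> V" for i j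
      using cont that by (intro continuous_closedin_preimage_constant continuous_intros) auto
    then have "closedin (top_of_set {0..1}) (\<Inter>(i, j)\<in>V \<times> V. {t \<in> {0..1}. dist (x t i) (x t j) = dist (p i) (p j)})"
      using V(2) by (intro closedin_INT) auto
    moreover have "(\<Inter>(i, j)\<in>V \<times> V. {t \<in> {0..1}. dist (x t i) (x t j) = dist (p i) (p j)}) = A"
      using V(2) by (auto simp: A_def)
    ultimately show ?thesis by simp
  qed
  moreover have "openin (top_of_set {0..1}) A"
    unfolding openin_euclidean_subtopology_iff
  proof (intro conjI ballI)
    show "A \<subseteq> {0..1}" by (auto simp: A_def)
    fix t0 assume t0: "t0 \<in> A"
    show "\<exists>e>0. \<forall>t\<in>{0..1}. dist t t0 < e \<longrightarrow> t \<in> A"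
    proof (rule ccontr)
      assume neg: "\<not> ?thesis"
      \<comment> \<open>Failure of openness at \<open>t0\<close> produces times outside
        \<open>A\<close> that converge to \<open>t0\<close>.\<close>
      have "\<exists>t. t \<in> {0..1} \<and> dist t t0 < 1 / real (Suc n) \<and> t \<notin> A" for n
      proof (rule ccontr)
        assume "\<nexists>t. t \<in> {0..1} \<and> dist t t0 < 1 / real (Suc n) \<and> t \<notin> A"
        then have "\<forall>t\<in>{0..1}. dist t t0 < 1 / real (Suc n) \<longrightarrow> t \<in> A" by blast
        moreover have "1 / real (Suc n) > 0" by simp
        ultimately show False using neg by blast
      qed
      then obtain t where t01: "\<And>n. t n \<in> {0..1}" and tdist: "\<And>n. dist (t n) t0 < 1 / real (Suc n)"
        and tA: "\<And>n. t n \<notin> A" by metis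
      have tlim: "t \<longlonglongrightarrow> t0"
      proof (rule tendstoI)
        fix e :: real assume "e > 0"
        then obtain N where N: "1 / real (Suc N) < e" using nat_approx_posE by blast
        have "dist (t n) t0 < e" if "n \<ge> N" for n
        proof -
          have "1 / real (Suc n) \<le> 1 / real (Suc N)" using that by (intro divide_left_mono) auto
          then show ?thesis using tdist[of n] N by linarith
        qed
        then show "\<forall>\<^sub>F n in sequentially. dist (t n) t0 < e"
          unfolding eventually_sequentially by blast
      qed
      have xlim: "(\<lambda>n. x (t n) i) \<longlonglongrightarrow> x t0 i" if "i \<in> V" for i
        using continuous_on_tendsto_compose[of "{0..1}" "\<lambda>t. x t i" t t0 sequentially] cont that t0 t01 tlim
        by (auto simp: A_def)
      obtain T where T: "orthogonal_transformation T" and Tp: "\<And>i. i \<in> V \<Longrightarrow> T (p i - p i0) = x t0 i - x t0 i0"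
        using congruent_frames[OF V(2,3) det, of "x t0"] t0 by (auto simp: A_def)
      obtain T' where T': "orthogonal_transformation T'" "\<And>v. T' (T v) = v"
        using orthogonal_transformation_inv[OF T] orthogonal_transformation_inj[OF T]
        by (metis inv_f_f)
      \<comment> \<open>The isometry taking the framework at time \<open>t0\<close> to
        \<open>p\<close> is applied to the bad times; this keeps all distances and makes the
        sequence converge to \<open>p\<close>.\<close>
      define y where "y = (\<lambda>n i. p i0 + T' (x (t n) i - x t0 i0))"
      have ydist: "dist (y n i) (y n j) = dist (x (t n) i) (x (t n) j)" for n i j
      proof -
        have "T' (x (t n) i - x t0 i0) - T' (x (t n) j - x t0 i0) = T' (x (t n) i - x (t n) j)"
          using T'(1) unfolding orthogonal_transformation_def by (simp flip: linear_diff)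
        moreover have "norm (T' v) = norm v" for v using T'(1) by (simp add: orthogonal_transformation)
        ultimately show ?thesis by (simp add: y_def dist_norm)
      qed
      have "\<exists>n. \<forall>i\<in>V. \<forall>j\<in>V. dist (y n i) (y n j) = dist (p i) (p j)"
      proof (rule local_rigidity[OF V det])
        fix i assume i: "i \<in> V"
        have "bounded_linear T'" using T'(1) by (simp add: orthogonal_transformation_def linear_conv_bounded_linear)
        then have "(\<lambda>n. y n i) \<longlonglongrightarrow> p i0 + T' (x t0 i - x t0 i0)"
          unfolding y_def
          by (intro tendsto_add[OF tendsto_const] bounded_linear.tendsto[of T'] tendsto_diff[OF _ tendsto_const] xlim i)
        then show "(\<lambda>n. y n i) \<longlonglongrightarrow> p i" using T'(2)[of "p i - p i0"] Tp[OF i] by simp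
      next
        show "dist (y n i) (y n j) = dist (p i) (p j)" if "i \<in> V" "j \<in> V" "E i j" for n i j
          unfolding ydist using edge t01 that by blast
      next
        show "(p i - p j) \<bullet> (\<mu> i - \<mu> j) = 0"
          if "\<And>i j. i \<in> V \<Longrightarrow> j \<in> V \<Longrightarrow> E i j \<Longrightarrow> (p i - p j) \<bullet> (\<mu> i - \<mu> j) = 0" "i \<in> V" "j \<in> V" for \<mu> i j
          using IR that by blast
      qed
      then show False using tA t01 unfolding ydist A_def by blast
    qed
  qed
  moreover have "0 \<in> A" using x0 by (auto simp: A_def)
  ultimately have "A = {0..1}" using connected_clopen[of "{0..1::real}"] connected_Icc by blast
  then show "\<forall>t\<in>{0..1}. \<forall>u\<in>V. \<forall>v\<in>V. dist (x t u) (x t v) = dist (p u) (p v)"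
    by (auto simp: A_def)
qed

theorem theorem1p1:
  fixes V :: "'a set" and E :: "'a \<Rightarrow> 'a \<Rightarrow> bool"
  assumes "simple_graph V E"
    and "card V \<ge> 1"
    and "real (min_degree V E) \<ge> real (card V) / 2 + real CARD('d::finite) - 1"
  shows "graph_rigid V E TYPE('d)"
proof -
  have V: "finite V" "V \<noteq> {}" using assms(1,2) by (auto simp: simple_graph_def)
  \<comment> \<open>This is the largest \<open>k\<close> with
    \<open>2 * d + 2 * k \<le> card V\<close>; truncated subtraction is harmless because
    \<open>le\<close> forces \<open>2 * d \<le> card V\<close>.\<close>
  define k where "k = (card V - 2 * CARD('d)) div 2"
  have card: "Suc (degree V E i + card {j\<in>V. j \<noteq> i \<and> \<not> E i j}) = card V" if i: "i \<in> V" for i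
  proof -
    have "V = insert i ({u\<in>V. E i u} \<union> {j\<in>V. j \<noteq> i \<and> \<not> E i j})" using i by auto
    moreover have "i \<notin> {u\<in>V. E i u} \<union> {j\<in>V. j \<noteq> i \<and> \<not> E i j}" using assms(1) by (auto simp: simple_graph_def)
    ultimately have "card V = Suc (card ({u\<in>V. E i u} \<union> {j\<in>V. j \<noteq> i \<and> \<not> E i j}))"
      using V(1) by (metis card_insert_disjoint finite_insert)
    also have "card ({u\<in>V. E i u} \<union> {j\<in>V. j \<noteq> i \<and> \<not> E i j}) = degree V E i + card {j\<in>V. j \<noteq> i \<and> \<not> E i j}"
      unfolding degree_def using V(1) by (intro card_Un_disjoint) auto
    finally show ?thesis by simp
  qed
  have deg: "real (degree V E i) \<ge> real (card V) / 2 + real CARD('d) - 1" if "i \<in> V" for i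
  proof -
    have "min_degree V E \<le> degree V E i" using V that by (simp add: min_degree_def)
    then show ?thesis using assms(3) by linarith
  qed
  \<comment> \<open>Degree and complement degree add up to \<open>card V - 1\<close>, so the degree
    bound leaves at most \<open>card V / 2 - d\<close> non-neighbours.\<close>
  have le: "2 * CARD('d) + 2 * card {j\<in>V. j \<noteq> i \<and> \<not> E i j} \<le> card V" if "i \<in> V" for i
    using deg[OF that] card[OF that] by linarith
  obtain v where v: "v \<in> V" using V by blast
  have n: "2 * CARD('d) + 2 * k \<le> card V" using le[OF v] by (simp add: k_def)
  have "CARD('d) > 0" by simp
  then have "CARD('d) < card V" using n by linarith
  have "rigid_framework V E p" if p: "generic_framework V p" for p :: "'a \<Rightarrow> real ^ 'd"
  proof -
    obtain i0 h where h: "i0 \<in> V" "range h \<subseteq> V" "det (frame p i0 h) \<noteq> 0"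
      using generic_frame[OF V(1) p \<open>CARD('d) < card V\<close>] by blast
    show ?thesis
    proof (rule rigid_if_infinitesimally_rigid[OF V(1) h])
      show "(p i - p j) \<bullet> (\<mu> i - \<mu> j) = 0"
        if "\<And>i j. i \<in> V \<Longrightarrow> j \<in> V \<Longrightarrow> E i j \<Longrightarrow> (p i - p j) \<bullet> (\<mu> i - \<mu> j) = 0" "i \<in> V" "j \<in> V" for \<mu> i j
      proof (rule generic_infinitesimally_rigid[OF V(1) p _ n that(1) that(2,3)])
        show "card {j\<in>V. j \<noteq> i \<and> \<not> E i j} \<le> k" if "i \<in> V" for i
          using le[OF that] by (simp add: k_def)
      qed
    qed
  qed
  then show ?thesis by (auto simp: graph_rigid_def)
qed

end
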